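(* Let $k\geqslant 15$ and $n\geqslant k+20$ be integers, and let $B$ be a bicyclic graph with $k$ edges. Then the signed complete graph $(K_n,B)$ attains the maximum index (among all signed complete graphs $(K_n,B')$ with $B'$ a bicyclic graph with $k$ edges) if and only if $B$ is isomorphic to $\theta_2(0,k-5)$.
   Context: All graphs are finite and simple. A bicyclic graph is a connected graph $G$ with $|E(G)|=|V(G)|+1$. A signed graph $\Gamma=(G,\sigma)$ is a graph $G$ with a map $\sigma:E(G)\to\{1,-1\}$; its adjacency matrix $A(\Gamma)$ has $(i,j)$-entry $\sigma(v_iv_j)$ if $v_i\sim v_j$ and $0$ otherwise. The index $\lambda_1(\Gamma)$ is the largest eigenvalue of $A(\Gamma)$. For a graph $H$ without isolated vertices and with at most $n$ vertices, $(K_n,H)$ denotes the signed complete graph of order $n$ whose negative edges form (induce) a subgraph isomorphic to $H$, all other edges being positive. The graph $\theta_2(0,k-5)$ has $k$ edges and $k-1$ vertices: it has four vertices $v_1,v_2,u_1,\omega_1$ with the five edges $v_1v_2,\ v_1u_1,\ u_1v_2,\ v_1\omega_1,\ \omega_1v_2$ (two triangles sharing the edge $v_1v_2$), together with $k-5$ pendant vertices all adjacent to $v_2$. *)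

theory Defs
  imports
    "Graph_Theory.Graph_Theory"
    "Jordan_Normal_Form.Spectral_Radius"
begin

(* A finite simple graph is a pair_graph: a finite vertex set with a symmetric,
   irreflexive set of arcs.  Each undirected edge {u,v} corresponds to the two arcs
   (u,v) and (v,u), so edges are counted as unordered pairs. *)
definition uedges :: "'a pair_pre_digraph \<Rightarrow> 'a set set" where
  "uedges G = {{u, v} | u v. (u, v) \<in> parcs G}"

definition bicyclic :: "'a pair_pre_digraph \<Rightarrow> bool" where
  "bicyclic G \<longleftrightarrow> pair_graph G \<and> Digraph_Component.connected (with_proj G) \<and>
     card (uedges G) = card (pverts G) + 1"

abbreviation graph_iso :: "'a pair_pre_digraph \<Rightarrow> 'b pair_pre_digraph \<Rightarrow> bool" where
  "graph_iso G H \<equiv> digraph_iso (with_proj G) (with_proj H)"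

(* The sign map is only relevant on the edges of the underlying graph. *)
record 'a signed_graph =
  underlying :: "'a pair_pre_digraph"
  edge_sign :: "'a set \<Rightarrow> real"

definition is_signed_graph :: "'a signed_graph \<Rightarrow> bool" where
  "is_signed_graph \<Gamma> \<longleftrightarrow> pair_graph (underlying \<Gamma>) \<and>
     (\<forall>e \<in> uedges (underlying \<Gamma>). edge_sign \<Gamma> e \<in> {1, -1})"

(* Meaningful for signed graphs whose vertices are numbered 0, ..., n - 1. *)
definition adj_mat :: "nat signed_graph \<Rightarrow> real mat" where
  "adj_mat \<Gamma> = (let n = card (pverts (underlying \<Gamma>)) in
     mat n n (\<lambda>(i, j). if (i, j) \<in> parcs (underlying \<Gamma>) then edge_sign \<Gamma> {i, j} else 0))"

definition signed_index :: "nat signed_graph \<Rightarrow> real" where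
  "signed_index \<Gamma> = Max (spectrum (adj_mat \<Gamma>))"

(* The subgraph induced by the negative edges: its vertices are the endpoints of
   negative edges. *)
definition negative_subgraph :: "'a signed_graph \<Rightarrow> 'a pair_pre_digraph" where
  "negative_subgraph \<Gamma> =
     (let N = {(u, v) \<in> parcs (underlying \<Gamma>). edge_sign \<Gamma> {u, v} = -1}
      in \<lparr> pverts = Field N, parcs = N \<rparr>)"

(* is_signed_complete n H \<Gamma>: \<Gamma> is (a copy, on the vertices 0, ..., n - 1, of) the
   signed complete graph (K_n, H), which is determined only up to isomorphism. *)
definition is_signed_complete :: "nat \<Rightarrow> 'a pair_pre_digraph \<Rightarrow> nat signed_graph \<Rightarrow> bool" where
  "is_signed_complete n H \<Gamma> \<longleftrightarrow> is_signed_graph \<Gamma> \<and>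
     pverts (underlying \<Gamma>) = {..<n} \<and> complete_digraph n (with_proj (underlying \<Gamma>)) \<and>
     graph_iso (negative_subgraph \<Gamma>) H"

(* The graph \<theta>_2(0, r), with v1 = 0, v2 = 1, u1 = 2, \<omega>1 = 3 and the r pendant
   vertices 4, ..., r + 3 attached to v2. *)
definition theta2_0 :: "nat \<Rightarrow> nat pair_pre_digraph" where
  "theta2_0 r =
     \<lparr> pverts = {..<r + 4},
       parcs = symcl ({(0, 1), (0, 2), (2, 1), (0, 3), (3, 1)} \<union> {(1, p) | p. p \<in> {4..<r + 4}}) \<rparr>"

end

theory Submission
  imports Defs "HOL-Analysis.Convex"
begin

text \<open>
Adding the identity to the adjacency matrix of \<open>(K\<^sub>n, H)\<close> gives \<open>J - 2 A(H)\<close>, where \<open>J\<close> is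
the all-ones matrix. Its quadratic form is \<open>qform\<close>: the square of the sum of all coordinates, minus
twice the sum of \<open>x i * x j\<close> over the arcs of \<open>H\<close>. All competitors are compared with one number, the
level \<open>l\<close>, a root close to \<open>N = n - 1\<close> of the secular equation \<open>level_poly\<close> of \<open>\<theta>\<^sub>2(0, k - 5)\<close>.
For that graph the form is at most \<open>l\<close> times the square norm and an eigenvector attains \<open>l\<close>; for
every other graph the inequality is strict. So the index is \<open>l - 1\<close> in the first case and smaller
in the second.

The comparison singles out a hub \<open>v\<close>, a vertex of maximum degree \<open>d\<close> of \<open>H\<close>, and the \<open>m = k - d\<close>
edges that avoid it. Put \<open>t = x v\<close>, let \<open>s\<close> be the sum of the other coordinates, and let \<open>u i\<close> be
\<open>s - t\<close> on the neighbours of \<open>v\<close> and \<open>s + t\<close> elsewhere. Without the \<open>m\<close> edges the best choice of the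
other coordinates would be \<open>u i / l\<close>. Substituting \<open>x i = u i / l + z i\<close> splits
\<open>l * |x|\<^sup>2 - qform x\<close> into a binary quadratic form in \<open>(s, t)\<close> and a part quadratic in \<open>z\<close>
(\<open>qform_hub_expansion\<close>). The latter is bounded below by completing squares, because \<open>m\<close> edges have
least adjacency eigenvalue at least \<open>- sqrt m\<close>, which is small compared with \<open>l\<close>. It remains to see
that the binary form is positive (\<open>qform_hub_bound\<close>).

If \<open>m \<ge> 3\<close>, the determinant of the binary form is compared with that of \<open>\<theta>\<^sub>2(0, k - 5)\<close>, which
vanishes at \<open>l\<close>. Having \<open>m\<close> instead of two edges off the hub gains about
\<open>4 (m - 2) (2 d + m - 2)\<close> in the determinant, and the correction terms cost about
\<open>36 / 7\<close> times the sum of the squared degrees off the hub, plus \<open>16 m\<close> (\<open>secular_gap\<close>); the condition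
\<open>n \<ge> k + 20\<close> makes \<open>l\<close> large enough for these estimates. Bounding the sum of squares
(\<open>sum_deg_sq_le_vertex\<close>, \<open>sum_deg_sq_le_max\<close>) shows that the gain wins for \<open>k \<ge> 15\<close>
(\<open>degree_budget\<close>).

Since \<open>H\<close> has only \<open>k - 1\<close> vertices, the remaining case is \<open>m = 2\<close>, where the hub is adjacent to
every other vertex of \<open>H\<close>. The two edges off the hub either share a vertex, and then \<open>H\<close> is
\<open>\<theta>\<^sub>2(0, k - 5)\<close> and the binary form is exactly singular at \<open>l\<close>, or they are disjoint, and then the
form gains a positive multiple of \<open>(s - t)\<^sup>2\<close> (\<open>form_slack\<close>).
\<close>

section \<open>The secular equation of the extremal graph\<close>

text \<open>
This is the secular equation of the extremal graph with denominators cleared: \<open>d0 = k - 2\<close> is the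
degree of its hub, and the rational function \<open>8 * (l - 3) / (l\<^sup>2 - 8)\<close> (called \<open>R\<close> below) accounts for
the path formed by the two edges off the hub. With \<open>A\<close> the adjacency matrix of a path on three vertices,
the entries of the inverse of \<open>l + 2 A\<close> sum to \<open>(3 * l - 8) / (l\<^sup>2 - 8) = (3 - R) / l\<close>.
\<close>

definition level_poly :: "real \<Rightarrow> real \<Rightarrow> real \<Rightarrow> real" where
  "level_poly N d0 l = l\<^sup>2 * ((l - 1 - N) * (l\<^sup>2 - 8) + 8 * (l - 3)) + 4 * (d0 * (l\<^sup>2 - 8) - 8 * (l - 3)) * (N - d0)"

text \<open>
The polynomial changes sign between \<open>N - 1/4\<close> and \<open>N + 1\<close>. At the left end, after
division by \<open>l\<^sup>2 - 8\<close>, the dominant terms are \<open>4 * d0 * (N - d0)\<close>, at most \<open>N\<^sup>2\<close>, and about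
\<open>-5/4 * l\<^sup>2 + 8 * l\<close>.
\<close>

lemma level_exists:
  fixes N d0 :: real
  assumes "34 \<le> N" "13 \<le> d0" "d0 + 21 \<le> N"
  obtains l where "N - 1/4 \<le> l" "l \<le> N + 1" "level_poly N d0 l = 0"
proof -
  have "level_poly N d0 (N - 1/4) \<le> 0"
  proof -
    define l where "l = N - 1/4"
    have l: "135/4 \<le> l" "N = l + 1/4" using assms by (auto simp: l_def)
    have A: "8 * (l - 3) * l\<^sup>2 \<le> (8 * l - 20) * (l\<^sup>2 - 8)"
    proof -
      have "0 \<le> (l - 16) * l" using l by simp
      then show ?thesis by (simp add: algebra_simps power2_eq_square)
    qed
    have B: "4 * d0 * (N - d0) \<le> N\<^sup>2"
      using zero_le_power2[of "N - 2 * d0"] by (simp add: algebra_simps power2_eq_square)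
    have l2: "l\<^sup>2 - 8 \<ge> 0" using l mult_mono[of 33 l 33 l] by (simp add: power2_eq_square)
    have C: "N\<^sup>2 - 5/4 * l\<^sup>2 + 8 * l - 20 \<le> 0"
    proof -
      have "0 \<le> (l - 135/4) * (l - 1/4)" using l by simp
      then show ?thesis unfolding l(2) using l(1) by (simp only: algebra_simps power2_eq_square)
    qed
    have "level_poly N d0 l = (8 * (l - 3)) * l\<^sup>2 - 5/4 * l\<^sup>2 * (l\<^sup>2 - 8) + (4 * d0 * (N - d0)) * (l\<^sup>2 - 8) - 32 * (l - 3) * (N - d0)"
    proof -
      have e: "l - 1 - N = - (5/4)" using l(2) by simp
      show ?thesis unfolding level_poly_def e by (simp add: field_simps)
    qed
    also have "\<dots> \<le> (8 * l - 20) * (l\<^sup>2 - 8) - 5/4 * l\<^sup>2 * (l\<^sup>2 - 8) + N\<^sup>2 * (l\<^sup>2 - 8) - 0"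
      using A mult_right_mono[OF B l2] l assms by (intro diff_mono add_mono) auto
    also have "\<dots> = (N\<^sup>2 - 5/4 * l\<^sup>2 + 8 * l - 20) * (l\<^sup>2 - 8)" by (simp add: algebra_simps)
    also have "\<dots> \<le> 0" using C l2 by (simp add: mult_nonpos_nonneg)
    finally show ?thesis by (simp add: l_def)
  qed
  moreover have "0 \<le> level_poly N d0 (N + 1)"
  proof -
    define p where "p = (N + 1)\<^sup>2 - 8"
    have p: "8 * (N + 1 - 3) \<le> p"
      using assms zero_le_power2[of "N - 3"] by (simp add: p_def power2_eq_square algebra_simps)
    then have "1 * p \<le> d0 * p" using assms by (intro mult_right_mono) auto
    then have "0 \<le> d0 * p - 8 * (N + 1 - 3)" using p by linarith
    then show ?thesis using assms by (simp add: level_poly_def p_def)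
  qed
  moreover have "continuous_on {N - 1/4..N + 1} (level_poly N d0)"
    unfolding level_poly_def by (intro continuous_intros)
  ultimately show ?thesis using IVT'[of "level_poly N d0" "N - 1/4" 0 "N + 1"] that by auto
qed

lemma level_poly_root:
  assumes "level_poly N d0 l = 0" "l\<^sup>2 > 8"
  shows "l\<^sup>2 * (l - 1 - N + 8 * (l - 3) / (l\<^sup>2 - 8)) + 4 * (d0 - 8 * (l - 3) / (l\<^sup>2 - 8)) * (N - d0) = 0"
proof -
  define p where "p = l\<^sup>2 - 8"
  have p: "p > 0" using assms(2) by (simp add: p_def)
  have "l\<^sup>2 * ((l - 1 - N) * p + 8 * (l - 3)) + 4 * (d0 * p - 8 * (l - 3)) * (N - d0) = 0"
    using assms(1) by (simp add: level_poly_def p_def)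
  moreover define R where "R = 8 * (l - 3) / p"
  moreover have Rp: "8 * (l - 3) = R * p" using p by (simp add: R_def)
  ultimately have "(l\<^sup>2 * (l - 1 - N + R) + 4 * (d0 - R) * (N - d0)) * p = 0"
    unfolding Rp by (simp add: algebra_simps)
  then show ?thesis using p unfolding p_def[symmetric] R_def by simp
qed

section \<open>Arc relations, degrees and the quadratic form\<close>

text \<open>
A finite simple graph on \<open>V\<close>, given by its symmetric set of arcs. Vertices outside the field of \<open>E\<close>
are kept, since \<open>V\<close> will be the vertex set of the complete graph and \<open>E\<close> its negative arcs.
\<close>

locale arc_graph =
  fixes V :: "'a set" and E :: "('a \<times> 'a) set"
  assumes finite_V: "finite V" and E_sub: "E \<subseteq> V \<times> V" and sym_E: "sym E" and irrefl_E: "irrefl E"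

definition deg :: "('a \<times> 'a) set \<Rightarrow> 'a \<Rightarrow> nat" where
  "deg E i = card (E `` {i})"

definition avoid :: "('a \<times> 'a) set \<Rightarrow> 'a \<Rightarrow> ('a \<times> 'a) set" where
  "avoid E v = {(i, j) \<in> E. i \<noteq> v \<and> j \<noteq> v}"

definition qform :: "'a set \<Rightarrow> ('a \<times> 'a) set \<Rightarrow> ('a \<Rightarrow> real) \<Rightarrow> real" where
  "qform V E x = (\<Sum>i\<in>V. x i)\<^sup>2 - 2 * (\<Sum>(i, j)\<in>E. x i * x j)"

context arc_graph
begin

lemma finite_E: "finite E"
  using finite_V E_sub finite_subset by blast

lemma E_symD: "(i, j) \<in> E \<Longrightarrow> (j, i) \<in> E"
  using sym_E by (auto dest: symD)

lemma E_irreflD: "(i, j) \<in> E \<Longrightarrow> i \<noteq> j"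
  using irrefl_E by (auto simp: irrefl_def)

lemma nbrs_sub: "E `` {i} \<subseteq> V"
  using E_sub by auto

lemma finite_nbrs: "finite (E `` {i})"
  using finite_subset[OF nbrs_sub finite_V] .

lemma arc_graph_avoid: "arc_graph (V - {v}) (avoid E v)"
proof
  show "finite (V - {v})" using finite_V by simp
  show "avoid E v \<subseteq> (V - {v}) \<times> (V - {v})" using E_sub by (auto simp: avoid_def)
  show "sym (avoid E v)" using sym_E by (auto simp: avoid_def sym_def)
  show "irrefl (avoid E v)" using irrefl_E by (auto simp: avoid_def irrefl_def)
qed

lemma sum_arcs: "(\<Sum>(i, j)\<in>E. f i j) = (\<Sum>i\<in>V. \<Sum>j\<in>E `` {i}. f i j)"
proof -
  have "E = Sigma V (\<lambda>i. E `` {i})" using E_sub by auto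
  then show ?thesis using sum.Sigma[of V "\<lambda>i. E `` {i}" f] finite_V finite_nbrs by simp
qed

lemma sum_arcs_swap: "(\<Sum>(i, j)\<in>E. f i j) = (\<Sum>(i, j)\<in>E. f j i)"
proof -
  have "E = prod.swap ` E" using E_symD by force
  then have "sum (case_prod f) E = sum (case_prod f) (prod.swap ` E)" by simp
  also have "\<dots> = sum (case_prod f \<circ> prod.swap) E"
    by (rule sum.reindex) (auto intro: inj_onI)
  finally show ?thesis by (simp add: case_prod_beta comp_def)
qed

lemma sum_deg: "(\<Sum>i\<in>V. deg E i) = card E"
proof -
  have "card E = (\<Sum>(i, j)\<in>E. 1::nat)" by (simp add: case_prod_beta)
  also have "\<dots> = (\<Sum>i\<in>V. deg E i)" by (subst sum_arcs) (simp add: deg_def)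
  finally show ?thesis by simp
qed

text \<open>
A set of arcs without opposite pairs selects each edge at most once.
\<close>

lemma card_oriented: 
  assumes "S \<subseteq> E" "S \<inter> S\<inverse> = {}"
  shows "2 * card S \<le> card E"
proof -
  have f: "finite S" using assms(1) finite_E finite_subset by blast
  have "card (S \<union> S\<inverse>) = card S + card (S\<inverse>)"
    using f assms(2) by (intro card_Un_disjoint) auto
  moreover have "card (S \<union> S\<inverse>) \<le> card E"
    using assms(1) E_symD by (intro card_mono finite_E) auto
  ultimately show ?thesis by simp
qed

text \<open>
The least eigenvalue of a graph with \<open>m\<close> edges is at least \<open>- sqrt m\<close>. Only edges between positive
and negative coordinates contribute negatively. By Cauchy-Schwarz over at most \<open>m\<close> such edges, their
contribution is controlled by the product of the square norms of the positive and the
negative part, which is at most a quarter of the square of the whole.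
\<close>

lemma least_eigenvalue_bound:
  fixes z :: "'a \<Rightarrow> real"
  assumes m: "card E = 2 * m" and r: "0 \<le> r" "real m \<le> r\<^sup>2"
  shows "- r * (\<Sum>i\<in>V. (z i)\<^sup>2) \<le> (\<Sum>(i, j)\<in>E. z i * z j)"
proof -
  define P where "P = {i \<in> V. 0 < z i}"
  define M where "M = {i \<in> V. z i < 0}"
  define S where "S = E \<inter> P \<times> M"
  define T where "T = (\<Sum>i\<in>V. (z i)\<^sup>2)"
  define X where "X = (\<Sum>(i, j)\<in>S. z i * z j)"
  have T0: "0 \<le> T" by (simp add: T_def sum_nonneg)
  have PM: "P \<inter> M = {}" "P \<subseteq> V" "M \<subseteq> V" by (auto simp: P_def M_def)
  have fin: "finite P" "finite M" "finite S"
    using finite_V finite_E by (auto simp: P_def M_def S_def)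
  have disj: "S \<inter> S\<inverse> = {}" using PM by (auto simp: S_def)
  have cS: "card S \<le> m" using card_oriented[OF _ disj] m by (simp add: S_def)
  have "(\<Sum>(i, j)\<in>S \<union> S\<inverse>. z i * z j) \<le> (\<Sum>(i, j)\<in>E. z i * z j)"
  proof (rule sum_mono2)
    show "finite E" by (rule finite_E)
    show "S \<union> S\<inverse> \<subseteq> E" using E_symD by (auto simp: S_def)
    fix e assume "e \<in> E - (S \<union> S\<inverse>)"
    then obtain i j where e: "e = (i, j)" "(i, j) \<in> E" "(i, j) \<notin> S" "(j, i) \<notin> S" by (cases e) auto
    then have "i \<in> V" "j \<in> V" "(j, i) \<in> E" using E_sub E_symD by auto
    then have "\<not> (0 < z i \<and> z j < 0)" "\<not> (0 < z j \<and> z i < 0)" using e by (auto simp: S_def P_def M_def)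
    then show "0 \<le> (case e of (i, j) \<Rightarrow> z i * z j)" 
      by (simp add: e zero_le_mult_iff) linarith
  qed
  moreover have "(\<Sum>(i, j)\<in>S \<union> S\<inverse>. z i * z j) = 2 * X"
  proof -
    have "S\<inverse> = prod.swap ` S" by force
    then have "(\<Sum>(i, j)\<in>S\<inverse>. z i * z j) = X"
      by (simp add: X_def sum.reindex case_prod_beta mult.commute)
    then show ?thesis using disj fin by (subst sum.union_disjoint) (auto simp: X_def)
  qed
  moreover have "X\<^sup>2 \<le> (r * T / 2)\<^sup>2"
  proof -
    have "X\<^sup>2 \<le> (\<Sum>(i, j)\<in>S. (z i * z j)\<^sup>2) * real (card S)"
      unfolding X_def using sum_squared_le_sum_of_squares[of "\<lambda>(i, j). z i * z j" S] fin
      by (simp add: case_prod_beta)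
    also have "\<dots> \<le> (\<Sum>(i, j)\<in>S. (z i * z j)\<^sup>2) * r\<^sup>2"
      using cS r by (intro mult_left_mono sum_nonneg) (auto simp: case_prod_beta)
    also have "(\<Sum>(i, j)\<in>S. (z i * z j)\<^sup>2) \<le> (\<Sum>(i, j)\<in>P \<times> M. (z i * z j)\<^sup>2)"
      using fin by (intro sum_mono2) (auto simp: S_def)
    also have "\<dots> = (\<Sum>i\<in>P. (z i)\<^sup>2) * (\<Sum>j\<in>M. (z j)\<^sup>2)"
      by (simp add: sum_product sum.cartesian_product power_mult_distrib)
    also have "\<dots> \<le> (T / 2)\<^sup>2"
    proof -
      let ?A = "\<Sum>i\<in>P. (z i)\<^sup>2" and ?B = "\<Sum>i\<in>M. (z i)\<^sup>2"
      have "?A + ?B = (\<Sum>i\<in>P \<union> M. (z i)\<^sup>2)" using PM fin by (simp add: sum.union_disjoint)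
      also have "\<dots> \<le> T" unfolding T_def using PM finite_V by (intro sum_mono2) auto
      finally have "(?A + ?B)\<^sup>2 \<le> T\<^sup>2" by (intro power_mono) (auto intro!: add_nonneg_nonneg sum_nonneg)
      then show ?thesis using zero_le_power2[of "?A - ?B"] by (simp add: power2_eq_square algebra_simps)
    qed
    finally show ?thesis by (simp add: mult_right_mono power_mult_distrib power_divide mult.commute)
  qed
  then have "\<bar>X\<bar> \<le> r * T / 2" using r T0 by (simp add: power2_le_iff_abs_le)
  ultimately show ?thesis by (simp add: T_def[symmetric])
qed

lemma sum_arcs_hub:
  fixes x :: "'a \<Rightarrow> real"
  shows "(\<Sum>(i, j)\<in>E. x i * x j) = 2 * x v * (\<Sum>j\<in>E `` {v}. x j) + (\<Sum>(i, j)\<in>avoid E v. x i * x j)"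
proof -
  have "E = Pair v ` (E `` {v}) \<union> ((\<lambda>j. (j, v)) ` (E `` {v}) \<union> avoid E v)"
    using E_symD by (auto simp: avoid_def)
  moreover have "Pair v ` (E `` {v}) \<inter> ((\<lambda>j. (j, v)) ` (E `` {v}) \<union> avoid E v) = {}"
    "(\<lambda>j. (j, v)) ` (E `` {v}) \<inter> avoid E v = {}"
    using E_irreflD by (auto simp: avoid_def)
  moreover have "finite (avoid E v)" using finite_E by (rule rev_finite_subset) (auto simp: avoid_def)
  ultimately have "(\<Sum>(i, j)\<in>E. x i * x j) = (\<Sum>(i, j)\<in>Pair v ` (E `` {v}). x i * x j)
     + ((\<Sum>(i, j)\<in>(\<lambda>j. (j, v)) ` (E `` {v}). x i * x j) + (\<Sum>(i, j)\<in>avoid E v. x i * x j))"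
    using finite_nbrs[of v] by (metis (no_types, lifting) finite_UnI finite_imageI sum.union_disjoint)
  then show ?thesis by (simp add: sum.reindex inj_on_def sum_distrib_left algebra_simps)
qed

lemma card_avoid: "card E = card (avoid E v) + 2 * deg E v"
proof -
  have "real (card E) = 2 * real (deg E v) + real (card (avoid E v))"
    using sum_arcs_hub[of "\<lambda>_. 1" v] by (simp add: deg_def case_prod_beta)
  then show ?thesis by linarith
qed

lemma deg_avoid: "i \<noteq> v \<Longrightarrow> deg E i = deg (avoid E v) i + (if (v, i) \<in> E then 1 else 0)"
proof -
  assume i: "i \<noteq> v"
  show ?thesis
  proof (cases "(v, i) \<in> E")
    case True
    then have "E `` {i} = insert v (avoid E v `` {i})" using i E_symD by (auto simp: avoid_def)
    moreover have "v \<notin> avoid E v `` {i}" by (auto simp: avoid_def)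
    moreover have "finite (avoid E v `` {i})" using finite_nbrs[of i] by (rule rev_finite_subset) (auto simp: avoid_def)
    ultimately show ?thesis using True by (simp add: deg_def)
  next
    case False
    then have "E `` {i} = avoid E v `` {i}" using i E_symD by (auto simp: avoid_def)
    then show ?thesis using False by (simp add: deg_def)
  qed
qed

lemma deg_le: "2 * deg E v \<le> card E"
  using card_avoid[of v] by simp

lemma max_degree_vertex:
  assumes "V \<noteq> {}"
  obtains v where "v \<in> V" "\<And>i. deg E i \<le> deg E v"
proof -
  have "Max (deg E ` V) \<in> deg E ` V" using finite_V assms by (intro Max_in) auto
  then obtain v where v: "v \<in> V" "deg E v = Max (deg E ` V)" by auto
  have "deg E i \<le> deg E v" for i
  proof (cases "i \<in> V")
    case True
    then show ?thesis unfolding v(2) using finite_V by (intro Max_ge) auto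
  next
    case False
    then have "E `` {i} = {}" using E_sub by auto
    then show ?thesis by (simp add: deg_def)
  qed
  then show thesis using that v(1) by blast
qed

lemma sum_deg_sq: "(\<Sum>i\<in>V. (deg E i)\<^sup>2) = (\<Sum>(i, j)\<in>E. deg E i)"
  by (subst sum_arcs) (simp add: deg_def power2_eq_square)

text \<open>
The sum of the squared degrees is the sum of \<open>deg i + deg j\<close> over the edges, and the two ends of an
edge meet at most \<open>m + 1\<close> edges, counted with multiplicity.
\<close>

lemma sum_deg_sq_le_size:
  assumes m: "card E = 2 * m"
  shows "(\<Sum>i\<in>V. (deg E i)\<^sup>2) \<le> m * (m + 1)"
proof -
  have "2 * (\<Sum>i\<in>V. (deg E i)\<^sup>2) = (\<Sum>(i, j)\<in>E. deg E i + deg E j)"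
    using sum_arcs_swap[of "\<lambda>i j. deg E i"] by (simp add: sum_deg_sq case_prod_beta sum.distrib)
  also have "\<dots> \<le> (\<Sum>(i, j)\<in>E. m + 1)"
  proof (intro sum_mono)
    fix e assume "e \<in> E"
    then obtain i j where e: "e = (i, j)" "(i, j) \<in> E" "i \<noteq> j" using E_irreflD by (cases e) auto
    interpret D: arc_graph "V - {i}" "avoid E i" by (rule arc_graph_avoid)
    have "2 * deg (avoid E i) j \<le> card (avoid E i)" by (rule D.deg_le)
    then have "2 * (deg E i + deg E j) \<le> card E + 2"
      using card_avoid[of i] deg_avoid[of j i] e by simp
    then show "(case e of (i, j) \<Rightarrow> deg E i + deg E j) \<le> (case e of (i, j) \<Rightarrow> m + 1)"
      using m e by simp
  qed
  also have "\<dots> = 2 * (m * (m + 1))" using m by (simp add: case_prod_beta)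
  finally show ?thesis by simp
qed

text \<open>
Separating one vertex \<open>p\<close> improves the previous bound when the degrees are spread out: the edges
at \<open>p\<close> and the remaining \<open>m - deg p\<close> edges contribute two separate squares.
\<close>

lemma sum_deg_sq_le_vertex:
  assumes m: "card E = 2 * m" and p: "p \<in> V"
  shows "(\<Sum>i\<in>V. (deg E i)\<^sup>2) \<le> (deg E p)\<^sup>2 + deg E p + (m - deg E p)\<^sup>2 + 5 * (m - deg E p)"
proof -
  interpret D: arc_graph "V - {p}" "avoid E p" by (rule arc_graph_avoid)
  define c :: "'a \<Rightarrow> nat" where "c i = (if (p, i) \<in> E then 1 else 0)" for i
  have m': "card (avoid E p) = 2 * (m - deg E p)" using card_avoid[of p] m by simp
  have "(\<Sum>i\<in>V. (deg E i)\<^sup>2) = (deg E p)\<^sup>2 + (\<Sum>i\<in>V - {p}. (deg E i)\<^sup>2)"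
    using finite_V p by (simp add: sum.remove)
  also have "(\<Sum>i\<in>V - {p}. (deg E i)\<^sup>2) \<le> (\<Sum>i\<in>V - {p}. (deg (avoid E p) i)\<^sup>2 + 2 * deg (avoid E p) i + c i)"
    by (intro sum_mono) (auto simp: deg_avoid c_def power2_eq_square)
  also have "\<dots> = (\<Sum>i\<in>V - {p}. (deg (avoid E p) i)\<^sup>2) + 2 * card (avoid E p) + (\<Sum>i\<in>V - {p}. c i)"
    by (simp add: sum.distrib D.sum_deg sum_distrib_left[symmetric])
  also have "(\<Sum>i\<in>V - {p}. c i) = deg E p"
  proof -
    have "{i \<in> V - {p}. (p, i) \<in> E} = E `` {p}" using E_sub E_irreflD by auto
    then show ?thesis using finite_V by (simp add: c_def deg_def sum.If_cases Int_def)
  qed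
  also have "(\<Sum>i\<in>V - {p}. (deg (avoid E p) i)\<^sup>2) \<le> (m - deg E p) * (m - deg E p + 1)"
    by (rule D.sum_deg_sq_le_size[OF m'])
  finally show ?thesis using m' by (simp add: power2_eq_square algebra_simps)
qed

text \<open>
Every degree lies between \<open>1\<close> and \<open>D\<close> on the field, so \<open>(deg i - 1) * (D - deg i) \<ge> 0\<close>; this is summed.
\<close>

lemma sum_deg_sq_le_max:
  assumes D: "\<And>i. deg E i \<le> D"
  shows "(\<Sum>i\<in>V. (deg E i)\<^sup>2) + D * card (Field E) \<le> (D + 1) * card E"
proof -
  have F: "Field E \<subseteq> V" using E_sub by (auto simp: Field_def)
  have zero: "deg E i = 0" if "i \<notin> Field E" for i
  proof -
    have "E `` {i} = {}" using that by (auto simp: Field_def)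
    then show ?thesis by (simp add: deg_def)
  qed
  have pos: "1 \<le> deg E i" if "i \<in> Field E" for i
  proof -
    have "E `` {i} \<noteq> {}" using that E_symD by (auto simp: Field_def)
    then show ?thesis using finite_nbrs[of i] by (simp add: deg_def Suc_le_eq card_gt_0_iff)
  qed
  have "(\<Sum>i\<in>V. (deg E i)\<^sup>2) = (\<Sum>i\<in>Field E. (deg E i)\<^sup>2)"
    using F finite_V zero by (intro sum.mono_neutral_right) auto
  then have "(\<Sum>i\<in>V. (deg E i)\<^sup>2) + D * card (Field E) = (\<Sum>i\<in>Field E. (deg E i)\<^sup>2 + D)"
    by (simp add: sum.distrib)
  also have "\<dots> \<le> (\<Sum>i\<in>Field E. (D + 1) * deg E i)"
  proof (intro sum_mono)
    fix i assume i: "i \<in> Field E"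
    obtain a where a: "deg E i = a + 1" using pos[OF i] by (metis add.commute le_Suc_ex)
    obtain b where b: "D = a + 1 + b" using D[of i] a by (metis le_Suc_ex)
    show "(deg E i)\<^sup>2 + D \<le> (D + 1) * deg E i"
      unfolding a b by (simp add: power2_eq_square algebra_simps)
  qed
  also have "\<dots> \<le> (\<Sum>i\<in>V. (D + 1) * deg E i)" using F finite_V by (intro sum_mono2) auto
  also have "\<dots> = (D + 1) * card E" by (simp only: sum_distrib_left[symmetric] sum_deg)
  finally show ?thesis .
qed

text \<open>
Completing the square around the optimum \<open>u i / l\<close> of the graph in which only the edges at \<open>v\<close> are
present. The last bracket contains everything that depends on \<open>z\<close>.
\<close>

lemma qform_hub_expansion:
  fixes x :: "'a \<Rightarrow> real" and l :: real
  assumes v: "v \<in> V" and l: "l \<noteq> 0"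
  defines "t \<equiv> x v" and "s \<equiv> (\<Sum>i\<in>V - {v}. x i)"
  defines "u \<equiv> \<lambda>i. if (v, i) \<in> E then s - t else s + t"
  defines "z \<equiv> \<lambda>i. x i - u i / l"
  shows "l * (\<Sum>i\<in>V. (x i)\<^sup>2) - qform V E x
    = s\<^sup>2 + (l - 1) * t\<^sup>2
      - (real (deg E v) * (s - t)\<^sup>2 + (real (card V - 1) - real (deg E v)) * (s + t)\<^sup>2) / l
      + 2 / l\<^sup>2 * (\<Sum>(i, j)\<in>avoid E v. u i * u j)
      + (l * (\<Sum>i\<in>V - {v}. (z i)\<^sup>2)
         + 4 / l * (\<Sum>i\<in>V - {v}. z i * (\<Sum>j\<in>avoid E v `` {i}. u j))
         + 2 * (\<Sum>(i, j)\<in>avoid E v. z i * z j))"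
proof -
  interpret D: arc_graph "V - {v}" "avoid E v" by (rule arc_graph_avoid)
  define Y where "Y = V - {v}"
  have Y: "finite Y" "E `` {v} \<subseteq> Y" using finite_V nbrs_sub[of v] E_irreflD[of v v] by (auto simp: Y_def)
  have split: "(\<Sum>i\<in>Y. if (v, i) \<in> E then f i else g i) = (\<Sum>i\<in>E `` {v}. f i) + (\<Sum>i\<in>Y - E `` {v}. g i)" for f g :: "'a \<Rightarrow> real"
  proof -
    have "Y \<inter> {i. (v, i) \<in> E} = E `` {v}" "Y \<inter> - {i. (v, i) \<in> E} = Y - E `` {v}" using Y by auto
    then show ?thesis using Y by (simp add: sum.If_cases)
  qed
  define c where "c = (\<Sum>i\<in>E `` {v}. x i)"
  have cY: "(\<Sum>i\<in>Y - E `` {v}. x i) = s - c"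
    using Y by (simp add: sum_diff c_def s_def Y_def)
  have ux: "(\<Sum>i\<in>Y. u i * x i) = s\<^sup>2 + t * s - 2 * t * c"
  proof -
    have "(\<Sum>i\<in>Y. u i * x i) = (\<Sum>i\<in>Y. if (v, i) \<in> E then (s - t) * x i else (s + t) * x i)"
      by (intro sum.cong) (auto simp: u_def)
    also have "\<dots> = (s - t) * c + (s + t) * (s - c)"
      by (simp only: split sum_distrib_left[symmetric] cY) (simp add: c_def)
    finally show ?thesis by (simp add: algebra_simps power2_eq_square)
  qed
  have uu: "(\<Sum>i\<in>Y. (u i)\<^sup>2) = real (deg E v) * (s - t)\<^sup>2 + (real (card V - 1) - real (deg E v)) * (s + t)\<^sup>2"
  proof -
    have "(\<Sum>i\<in>Y. (u i)\<^sup>2) = (\<Sum>i\<in>Y. if (v, i) \<in> E then (s - t)\<^sup>2 else (s + t)\<^sup>2)"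
      by (intro sum.cong) (auto simp: u_def)
    also have "\<dots> = real (deg E v) * (s - t)\<^sup>2 + real (card (Y - E `` {v})) * (s + t)\<^sup>2"
      by (simp add: split deg_def)
    also have "real (card (Y - E `` {v})) = real (card V - 1) - real (deg E v)"
    proof -
      have "card (E `` {v}) \<le> card Y" using Y by (rule card_mono)
      moreover have "card Y = card V - 1" using v finite_V by (simp add: Y_def)
      ultimately show ?thesis using Y finite_nbrs[of v] by (simp add: card_Diff_subset deg_def of_nat_diff)
    qed
    finally show ?thesis .
  qed
  have zz: "(\<Sum>i\<in>Y. (x i)\<^sup>2) = (\<Sum>i\<in>Y. (z i)\<^sup>2) + 2 / l * (\<Sum>i\<in>Y. u i * x i) - (\<Sum>i\<in>Y. (u i)\<^sup>2) / l\<^sup>2"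
  proof -
    have "(z i)\<^sup>2 = (x i)\<^sup>2 - 2 / l * (u i * x i) + (u i)\<^sup>2 / l\<^sup>2" for i
      using l by (simp add: z_def field_simps power2_eq_square)
    then show ?thesis by (simp add: sum.distrib sum_subtractf sum_distrib_left sum_divide_distrib)
  qed
  have ee: "(\<Sum>(i, j)\<in>avoid E v. x i * x j)
    = (\<Sum>(i, j)\<in>avoid E v. u i * u j) / l\<^sup>2 + 2 / l * (\<Sum>i\<in>Y. z i * (\<Sum>j\<in>avoid E v `` {i}. u j)) + (\<Sum>(i, j)\<in>avoid E v. z i * z j)"
  proof -
    have a: "x i * x j = u i * u j / l\<^sup>2 + (z i * u j) / l + (z j * u i) / l + z i * z j" for i j
      using l by (simp add: z_def field_simps power2_eq_square)
    have b: "(\<Sum>i\<in>Y. z i * (\<Sum>j\<in>avoid E v `` {i}. u j)) = (\<Sum>(i, j)\<in>avoid E v. z i * u j)"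
      by (simp add: D.sum_arcs Y_def sum_distrib_left)
    have c: "(\<Sum>(i, j)\<in>avoid E v. z j * u i) = (\<Sum>(i, j)\<in>avoid E v. z i * u j)"
      using D.sum_arcs_swap[of "\<lambda>i j. z i * u j"] by simp
    show ?thesis unfolding b
      using c by (simp add: a case_prod_beta sum.distrib sum_divide_distrib[symmetric])
  qed
  have S: "(\<Sum>i\<in>V. x i) = t + s" "(\<Sum>i\<in>V. (x i)\<^sup>2) = t\<^sup>2 + (\<Sum>i\<in>Y. (x i)\<^sup>2)"
    using finite_V v by (simp_all add: sum.remove s_def t_def Y_def)
  have h: "(\<Sum>(i, j)\<in>E. x i * x j) = 2 * t * c + (\<Sum>(i, j)\<in>avoid E v. x i * x j)"
    by (simp add: sum_arcs_hub[of x v] t_def c_def)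
  show ?thesis
    unfolding qform_def S h ee zz ux uu[symmetric] Y_def[symmetric]
    using l by (simp add: field_simps power2_eq_square)
qed

text \<open>
Since \<open>9 * sqrt m \<le> l\<close>, at least \<open>7/9\<close> of \<open>l * |z|\<^sup>2\<close> survives the edge term \<open>2 * z i * z j\<close>. The
mixed term is then absorbed by a square, at the price \<open>(4 / l)\<^sup>2 / (4 * (7/9) * l) = 36 / 7 / l ^ 3\<close>
per squared entry of \<open>A u\<close>, with \<open>A\<close> the adjacency matrix off the hub.
\<close>

lemma qform_hub_bound:
  fixes x :: "'a \<Rightarrow> real" and l :: real
  assumes v: "v \<in> V" and l: "l > 0" and m: "card (avoid E v) = 2 * m" "81 * real m \<le> l\<^sup>2"
  defines "t \<equiv> x v" and "s \<equiv> (\<Sum>i\<in>V - {v}. x i)"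
  defines "u \<equiv> \<lambda>i. if (v, i) \<in> E then s - t else s + t"
  shows "s\<^sup>2 + (l - 1) * t\<^sup>2
      - (real (deg E v) * (s - t)\<^sup>2 + (real (card V - 1) - real (deg E v)) * (s + t)\<^sup>2) / l
      + 2 / l\<^sup>2 * (\<Sum>(i, j)\<in>avoid E v. u i * u j)
      - 36 / 7 / l ^ 3 * (\<Sum>i\<in>V - {v}. (\<Sum>j\<in>avoid E v `` {i}. u j)\<^sup>2)
    \<le> l * (\<Sum>i\<in>V. (x i)\<^sup>2) - qform V E x"
proof -
  interpret D: arc_graph "V - {v}" "avoid E v" by (rule arc_graph_avoid)
  define z where "z i = x i - u i / l" for i
  define g where "g i = (\<Sum>j\<in>avoid E v `` {i}. u j)" for i
  have "- (l / 9) * (\<Sum>i\<in>V - {v}. (z i)\<^sup>2) \<le> (\<Sum>(i, j)\<in>avoid E v. z i * z j)"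
    using D.least_eigenvalue_bound[OF m(1), of "l / 9" z] l m(2) by (simp add: power_divide)
  moreover have "- (36 / 7 / l ^ 3) * (\<Sum>i\<in>V - {v}. (g i)\<^sup>2)
     \<le> 7 / 9 * l * (\<Sum>i\<in>V - {v}. (z i)\<^sup>2) + 4 / l * (\<Sum>i\<in>V - {v}. z i * g i)"
  proof -
    \<comment> \<open>the square that absorbs the mixed term\<close>
    have "0 \<le> (\<Sum>i\<in>V - {v}. 7 / 9 * l * (z i + 18 / 7 * g i / l\<^sup>2)\<^sup>2)"
      using l by (intro sum_nonneg) simp
    also have "\<dots> = (\<Sum>i\<in>V - {v}. 7 / 9 * l * (z i)\<^sup>2 + 4 / l * (z i * g i) + 36 / 7 / l ^ 3 * (g i)\<^sup>2)"
      using l by (intro sum.cong) (simp_all add: field_simps power2_eq_square power3_eq_cube)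
    finally show ?thesis by (simp only: sum.distrib sum_distrib_left[symmetric])
  qed
  moreover note qform_hub_expansion[OF v, of l x]
  ultimately show ?thesis using l unfolding z_def g_def u_def s_def t_def by simp
qed

text \<open>
The binary form says nothing when \<open>s = t = 0\<close>; in this degenerate case the least eigenvalue bound
alone gives strictness.
\<close>

lemma qform_hub_zero:
  fixes x :: "'a \<Rightarrow> real" and l :: real
  assumes v: "v \<in> V" and l: "l > 0" and m: "card (avoid E v) = 2 * m" "81 * real m \<le> l\<^sup>2"
    and t: "x v = 0" and s: "(\<Sum>i\<in>V - {v}. x i) = 0" and x: "\<exists>i\<in>V. x i \<noteq> 0"
  shows "qform V E x < l * (\<Sum>i\<in>V. (x i)\<^sup>2)"
proof -
  interpret D: arc_graph "V - {v}" "avoid E v" by (rule arc_graph_avoid)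
  have "- (l / 9) * (\<Sum>i\<in>V - {v}. (x i)\<^sup>2) \<le> (\<Sum>(i, j)\<in>avoid E v. x i * x j)"
    using D.least_eigenvalue_bound[OF m(1), of "l / 9" x] l m(2) by (simp add: power_divide)
  moreover have "0 < (\<Sum>i\<in>V - {v}. (x i)\<^sup>2)"
    using x t finite_V by (auto intro!: sum_pos2)
  then have "0 < 7 / 9 * l * (\<Sum>i\<in>V - {v}. (x i)\<^sup>2)" using l by simp
  moreover have "(\<Sum>i\<in>V. x i) = 0" "(\<Sum>i\<in>V. (x i)\<^sup>2) = (\<Sum>i\<in>V - {v}. (x i)\<^sup>2)"
    using finite_V v t s by (simp_all add: sum.remove)
  ultimately show ?thesis by (simp add: qform_def sum_arcs_hub[of x v] t)
qed

end

section \<open>Numerical estimates for three or more edges off the hub\<close>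

text \<open>
The next three lemmas show that the gain from the determinant exceeds the loss \<open>36 / 7 * w\<close>, where \<open>w\<close>
is the sum of the squared degrees off the hub and \<open>D\<close> the maximum degree there. The gap is small when
\<open>m + d = 15\<close> (for instance at \<open>m = 10\<close>, \<open>d = D = 5\<close>), so the small values of \<open>m\<close> and \<open>D\<close> are
treated one by one.
\<close>

lemma degree_budget_small:
  fixes m d D w :: real
  assumes "m \<in> {3,4,5,6,7,8,9,10,11,12,13}" "D \<in> {1,2,3,4,5,6,7,8,9,10,11,12}" "15 \<le> m + d" "3 \<le> d" "D \<le> d"
    and "D \<le> m" "w \<le> D\<^sup>2 + D + (m - D)\<^sup>2 + 5 * (m - D)" "w + D * (m - 2) \<le> 2 * m * (D + 1)"
  shows "36 / 7 * w < 4 * (m - 2) * (2 * d + m - 9 / 4) + 22 - 161 / 10 * m"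
  using assms by (auto simp: power2_eq_square)

text \<open>
The claim is hardest for \<open>d = D\<close>. The first bound on \<open>w\<close> is the sharper one for \<open>D \<ge> m / 2\<close>,
the second one for \<open>D \<le> m / 2\<close>.
\<close>

lemma degree_budget_large:
  fixes m d D w :: real
  assumes "10 \<le> m" "15 \<le> m + D" "1 \<le> D" "D \<le> m" "D \<le> d"
    and f: "w \<le> D\<^sup>2 + D + (m - D)\<^sup>2 + 5 * (m - D)" and g: "w + D * (m - 2) \<le> 2 * m * (D + 1)"
  shows "36 / 7 * w < 4 * (m - 2) * (2 * d + m - 9 / 4) + 22 - 161 / 10 * m"
proof -
  have mono: "4 * (m - 2) * (2 * D + m - 9 / 4) \<le> 4 * (m - 2) * (2 * d + m - 9 / 4)"
    using assms by (intro mult_left_mono) auto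
  show ?thesis
  proof (cases "m \<le> 2 * D")
    case True
    have "0 \<le> (m - D) * (2 * D - m)" "m * m \<le> m * (2 * D)"
      using True assms by (auto intro: mult_left_mono)
    \<comment> \<open>the tangent of \<open>m\<^sup>2\<close> at \<open>m = 10\<close>, where the estimate is tightest\<close>
    moreover have "20 * m - 100 \<le> m * m"
      using zero_le_power2[of "m - 10"] by (simp add: algebra_simps power2_eq_square)
    ultimately have "36 / 7 * w < 4 * (m - 2) * (2 * D + m - 9 / 4) + 22 - 161 / 10 * m" using f True assms(1-5)
      by (simp only: algebra_simps power2_eq_square)
    then show ?thesis using mono by linarith
  next
    case False
    have "0 \<le> (m - 10) * (D - 1)" "0 \<le> (m-10)*(m+D-15)"  "0 \<le> (m-10)*m" using assms by simp_all
    then have "36 / 7 * w < 4 * (m - 2) * (2 * D + m - 9 / 4) + 22 - 161 / 10 * m" using g False assms(1-5)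
      by (simp only: algebra_simps power2_eq_square)
    then show ?thesis using mono by linarith
  qed
qed

lemma degree_budget:
  fixes m d D w :: nat
  assumes "3 \<le> m" "3 \<le> d" "15 \<le> m + d" "1 \<le> D" "D \<le> m" "D \<le> d"
    and f: "w \<le> D\<^sup>2 + D + (m - D)\<^sup>2 + 5 * (m - D)" and g: "w + D * (m - 2) \<le> (D + 1) * (2 * m)"
  shows "36 / 7 * real w < 4 * (real m - 2) * (2 * real d + real m - 9 / 4) + 22 - 161 / 10 * real m"
proof -
  have f': "real w \<le> (real D)\<^sup>2 + real D + (real m - real D)\<^sup>2 + 5 * (real m - real D)"
  proof -
    have "real w \<le> real (D\<^sup>2 + D + (m - D)\<^sup>2 + 5 * (m - D))" using f by (rule of_nat_mono)
    then show ?thesis using assms by (simp add: of_nat_diff)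
  qed
  have g': "real w + real D * (real m - 2) \<le> 2 * real m * (real D + 1)"
  proof -
    have "real (w + D * (m - 2)) \<le> real ((D + 1) * (2 * m))" using g by (rule of_nat_mono)
    then show ?thesis using assms by (simp add: of_nat_diff algebra_simps)
  qed
  show ?thesis
  proof (cases "10 \<le> m \<and> 15 \<le> m + D")
    case True
    then show ?thesis using assms f' g' by (intro degree_budget_large[of _ "real D"]) auto
  next
    case False
    then have "m \<le> 13" "D \<le> 12" using assms by auto
    then have "m \<in> {3..<14}" "D \<in> {1..<13}" using assms by auto
    then have "m \<in> set [3..<14]" "D \<in> set [1..<13]" unfolding set_upt .
    then have "real m \<in> {3,4,5,6,7,8,9,10,11,12,13}" "real D \<in> {1,2,3,4,5,6,7,8,9,10,11,12}"
      by (auto simp add: upt_rec)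
    then show ?thesis using assms f' g' by (intro degree_budget_small[of _ "real D"]) auto
  qed
qed

text \<open>
After multiplication by \<open>l\<close>, the binary form of a graph with hub degree \<open>d\<close> is at least
\<open>(l - N + a) * s\<^sup>2 + (l\<^sup>2 - l - N - b) * t\<^sup>2 - 2 * (|N - 2 * d| + b) * |s * t|\<close>, where \<open>K = 36 / 7 * w\<close>.
Its determinant is expanded around that of the extremal graph, whose hub has degree \<open>d + m - 2\<close>, so
that the equation \<open>root\<close> eliminates the leading term \<open>l\<^sup>2 * (l - 1 - N)\<close>. What remains is
\<open>4 * (m - 2) * (2 * d + m - 2 + (l - N)) - K\<close> up to error terms of order \<open>m\<close>, and \<open>key\<close> decides.
\<close>

lemma secular_gap:
  fixes N d m l K R a b :: real
  assumes N: "34 \<le> N" and m: "3 \<le> m" and d: "3 \<le> d" and md: "m + d + 19 \<le> N"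
    and l: "N - 1/4 \<le> l" "l \<le> N + 1" and K: "0 \<le> K"
    and key: "K < 4 * (m - 2) * (2 * d + m - 9 / 4) + 22 - 161 / 10 * m"
    and R: "R = 8 * (l - 3) / (l\<^sup>2 - 8)"
    and root: "l\<^sup>2 * (l - 1 - N + R) + 4 * ((d + m - 2) - R) * (N - (d + m - 2)) = 0"
    and a: "a = 4 * m / l - K / l\<^sup>2" and b: "b = 4 * m / l + K / l\<^sup>2"
  shows "(\<bar>N - 2 * d\<bar> + b)\<^sup>2 < (l - N + a) * (l\<^sup>2 - l - N - b)"
    and "0 < l\<^sup>2 - l - N - b" and "0 \<le> b"
proof -
  have l0: "33 \<le> l" using l N by simp
  have ll: "1089 \<le> l\<^sup>2" using mult_mono[of 33 l 33 l] l0 by (simp add: power2_eq_square)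
  have ab: "a + b = 8 * m / l" by (simp add: a b)
  have ml: "m / l \<le> 1" using l0 md l d by (simp add: divide_le_eq)
  then have ab8: "a + b \<le> 8" using ab by simp
  define q where "q = K / l\<^sup>2"
  have b0: "0 \<le> b" using K m l0 by (simp add: b)
  have bK: "q \<le> b" using m l0 by (simp add: q_def b)
  have al: "a * l\<^sup>2 = 4 * m * l - K" using l0 by (simp add: a field_simps power2_eq_square)
  \<comment> \<open>the slack \<open>6\<close> pays for the lower-order terms \<open>b * (l - N)\<close> and \<open>b * (a + b)\<close>\<close>
  have absd: "\<bar>N - 2 * d\<bar> \<le> N - 6" using d md m by (simp add: abs_le_iff)
  have R0: "0 \<le> R" using l0 ll by (simp add: R)
  have R22: "22 \<le> 8 * l - l\<^sup>2 * R"
  proof -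
    have "33 * l \<le> l * l" using l0 by simp
    then have "l\<^sup>2 * (8 * (l - 3)) \<le> (8 * l - 22) * (l\<^sup>2 - 8)"
      using l0 by (simp only: algebra_simps power2_eq_square)
    then have "l\<^sup>2 * R \<le> 8 * l - 22" using ll by (simp add: R field_simps)
    then show ?thesis by simp
  qed
  have root': "l\<^sup>2 * (l - 1 - N) = - (l\<^sup>2 * R) - 4 * (d + m - 2) * (N - (d + m - 2)) + 4 * R * (N - (d + m - 2))"
    using root by (simp add: algebra_simps)
  have RN: "0 \<le> 4 * R * (N - (d + m - 2))" using R0 md by simp
  have exp: "(l - N + a) * (l\<^sup>2 - l - N - b) - (\<bar>N - 2 * d\<bar> + b)\<^sup>2
     = l\<^sup>2 * (l - 1 - N) + 4 * d * (N - d) + (4 * m * l - K) - a * (l + N) - b * (l - N) - 2 * b * \<bar>N - 2 * d\<bar> - b * (a + b)"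
  proof -
    have "\<bar>N - 2 * d\<bar>\<^sup>2 = (N - 2 * d)\<^sup>2" by simp
    then show ?thesis unfolding al[symmetric] by (simp add: algebra_simps power2_eq_square)
  qed
  have main: "l\<^sup>2 * (l - 1 - N) + 4 * d * (N - d) + (4 * m * l - K)
     \<ge> 4 * (m - 2) * (l - N + 2 * d + m - 2) + 22 - K"
    unfolding root' using RN R22 by (simp add: algebra_simps)
  have m1: "4 * (m - 2) * (2 * d + m - 9/4) \<le> 4 * (m - 2) * (l - N + 2 * d + m - 2)"
    using m l by (intro mult_left_mono) auto
  have c1: "2 * b * \<bar>N - 2 * d\<bar> \<le> 2 * b * N - 12 * b" using mult_left_mono[OF absd, of "2 * b"] b0 by (simp add: algebra_simps)
  have c2: "b * (l - N) \<le> b * 1" using l b0 by (intro mult_left_mono) auto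
  have c3: "b * (a + b) \<le> b * 8" using ab8 b0 by (intro mult_left_mono) auto
  define r where "r = N / l"
  have c4: "a * (l + N) + 2 * b * N = 4 * m * (1 + 3 * r) + q * (N - l)"
    using l0 by (simp add: r_def q_def a b field_simps)
  \<comment> \<open>\<open>l \<ge> N - 1/4\<close> and \<open>l \<ge> 33\<close>\<close>
  have c5: "r \<le> 1 + 1/132" using l l0 by (simp add: r_def field_simps)
  have c6: "4 * m * (1 + 3 * r) \<le> 4 * m * (1 + 3 * (1 + 1/132))"
    using c5 m by (intro mult_left_mono) auto
  have c7: "q * (N - l) \<le> q * (1/4)" using K l by (intro mult_left_mono) (auto simp: q_def)
  have t1: "a * (l + N) + 2 * b * N \<le> 161/10 * m + b"
  proof -
    have "4 * m * (1 + 3 * (1 + 1/132)) \<le> 161/10 * m" using m by simp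
    moreover have "q * (1/4) \<le> b" using bK b0 by simp
    ultimately show ?thesis unfolding c4 using c6 c7 by (intro add_mono) linarith+
  qed
  have "a * (l + N) + b * (l - N) + 2 * b * \<bar>N - 2 * d\<bar> + b * (a + b) \<le> 161/10 * m"
  proof -
    have "b * 1 = b" "b * 8 = 8 * b" by simp_all
    then show ?thesis using t1 c1 c2 c3 b0 by linarith
  qed
  then have "0 < (l - N + a) * (l\<^sup>2 - l - N - b) - (\<bar>N - 2 * d\<bar> + b)\<^sup>2"
    unfolding exp using main m1 key by linarith
  then show "(\<bar>N - 2 * d\<bar> + b)\<^sup>2 < (l - N + a) * (l\<^sup>2 - l - N - b)" by simp
  show "0 \<le> b" by (rule b0)
  show "0 < l\<^sup>2 - l - N - b"
  proof -
    have "(m - 2) * (2 * d + m - 9/4) \<le> l * (2 * l)"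
      using m d md l by (intro mult_mono) auto
    moreover have "4 * (m - 2) * (2 * d + m - 9/4) = 4 * ((m - 2) * (2 * d + m - 9/4))" "l * (2 * l) = 2 * l\<^sup>2"
      by (simp_all add: power2_eq_square)
    ultimately have "K \<le> 8 * l\<^sup>2 + 22" using key m by linarith
    then have "q \<le> 9" using ll by (simp add: q_def divide_le_eq)
    moreover have "b \<le> 4 + q" using ml by (simp add: b q_def)
    moreover have "33 * l \<le> l * l" using l0 by simp
    ultimately show ?thesis using l l0 unfolding power2_eq_square by linarith
  qed
qed

lemma binary_form_pos:
  fixes A T X s t :: real
  assumes "X\<^sup>2 < A * T" "0 < T" "0 \<le> X" "s \<noteq> 0 \<or> t \<noteq> 0"
  shows "0 < A * s\<^sup>2 + T * t\<^sup>2 - 2 * X * \<bar>s * t\<bar>"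
proof -
  have e: "T * (A * s\<^sup>2 + T * t\<^sup>2 - 2 * X * \<bar>s * t\<bar>) = (T * \<bar>t\<bar> - X * \<bar>s\<bar>)\<^sup>2 + (A * T - X\<^sup>2) * s\<^sup>2"
  proof -
    have "t\<^sup>2 = \<bar>t\<bar>\<^sup>2" "s\<^sup>2 = \<bar>s\<bar>\<^sup>2" by simp_all
    then show ?thesis by (simp only: abs_mult) (simp add: power2_eq_square algebra_simps)
  qed
  have "0 < (T * \<bar>t\<bar> - X * \<bar>s\<bar>)\<^sup>2 + (A * T - X\<^sup>2) * s\<^sup>2"
  proof (cases "s = 0")
    case True then show ?thesis using assms by simp
  next
    case False then show ?thesis using assms by (intro add_nonneg_pos) auto
  qed
  then show ?thesis using assms(2) unfolding e[symmetric] by (simp add: zero_less_mult_iff)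
qed

section \<open>Graphs with at least three edges off the hub\<close>

context arc_graph begin

text \<open>
The estimates are uniform in the position of the edges off the hub: each \<open>u i * u j\<close> is at least
\<open>s\<^sup>2 - 2 * |s * t| - t\<^sup>2\<close>, and each \<open>|u j|\<close> is at most \<open>|s| + |t|\<close>.
\<close>

lemma qform_lt_of_secular_gap:
  fixes x :: "'a \<Rightarrow> real" and l K N :: real
  assumes v: "v \<in> V" and l: "l > 0" and m: "card (avoid E v) = 2 * m" "81 * real m \<le> l\<^sup>2"
    and N: "N = real (card V - 1)" and d: "d = real (deg E v)"
    and K: "K = 36 / 7 * real (\<Sum>i\<in>V - {v}. (deg (avoid E v) i)\<^sup>2)"
    and a: "a = 4 * real m / l - K / l\<^sup>2" and b: "b = 4 * real m / l + K / l\<^sup>2"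
    and pd: "(\<bar>N - 2 * d\<bar> + b)\<^sup>2 < (l - N + a) * (l\<^sup>2 - l - N - b)" "0 < l\<^sup>2 - l - N - b" "0 \<le> b"
    and x: "\<exists>i\<in>V. x i \<noteq> 0"
  shows "qform V E x < l * (\<Sum>i\<in>V. (x i)\<^sup>2)"
proof -
  define t where "t = x v"
  define s where "s = (\<Sum>i\<in>V - {v}. x i)"
  show ?thesis
  proof (cases "s = 0 \<and> t = 0")
    case True
    then show ?thesis using qform_hub_zero[OF v l m] x by (simp add: s_def t_def)
  next
    case False
    interpret D: arc_graph "V - {v}" "avoid E v" by (rule arc_graph_avoid)
    define u where "u i = (if (v, i) \<in> E then s - t else s + t)" for i
    define w where "w = real (\<Sum>i\<in>V - {v}. (deg (avoid E v) i)\<^sup>2)"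
    have Kw: "K = 36 / 7 * w" unfolding K w_def ..
    have uu: "2 * real m * (s\<^sup>2 - 2 * \<bar>s * t\<bar> - t\<^sup>2) \<le> (\<Sum>(i, j)\<in>avoid E v. u i * u j)"
    proof -
      have "- (s * t) \<le> \<bar>s * t\<bar>" "s * t \<le> \<bar>s * t\<bar>" "0 \<le> \<bar>s * t\<bar>" "0 \<le> t * t" by simp_all
      then have "s\<^sup>2 - 2 * \<bar>s * t\<bar> - t\<^sup>2 \<le> u i * u j" for i j
        unfolding u_def power2_eq_square by (auto simp only: algebra_simps split: if_splits)
      then have "(\<Sum>(i, j)\<in>avoid E v. s\<^sup>2 - 2 * \<bar>s * t\<bar> - t\<^sup>2) \<le> (\<Sum>(i, j)\<in>avoid E v. u i * u j)"
        by (intro sum_mono) auto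
      then show ?thesis using m(1) by (simp add: case_prod_beta)
    qed
    have gg: "(\<Sum>i\<in>V - {v}. (\<Sum>j\<in>avoid E v `` {i}. u j)\<^sup>2) \<le> w * (s\<^sup>2 + 2 * \<bar>s * t\<bar> + t\<^sup>2)"
    proof -
      have "(\<Sum>j\<in>avoid E v `` {i}. u j)\<^sup>2 \<le> (real (deg (avoid E v) i))\<^sup>2 * (\<bar>s\<bar> + \<bar>t\<bar>)\<^sup>2" for i
      proof -
        have "\<bar>\<Sum>j\<in>avoid E v `` {i}. u j\<bar> \<le> (\<Sum>j\<in>avoid E v `` {i}. \<bar>s\<bar> + \<bar>t\<bar>)"
          by (rule order_trans[OF sum_abs sum_mono]) (auto simp: u_def)
        also have "\<dots> = real (deg (avoid E v) i) * (\<bar>s\<bar> + \<bar>t\<bar>)" by (simp add: deg_def)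
        finally have "\<bar>\<Sum>j\<in>avoid E v `` {i}. u j\<bar>\<^sup>2 \<le> (real (deg (avoid E v) i) * (\<bar>s\<bar> + \<bar>t\<bar>))\<^sup>2"
          by (intro power_mono) auto
        then show ?thesis by (simp add: power_mult_distrib)
      qed
      then have "(\<Sum>i\<in>V - {v}. (\<Sum>j\<in>avoid E v `` {i}. u j)\<^sup>2)
         \<le> (\<Sum>i\<in>V - {v}. (real (deg (avoid E v) i))\<^sup>2 * (\<bar>s\<bar> + \<bar>t\<bar>)\<^sup>2)" by (rule sum_mono)
      also have "\<dots> = w * (\<bar>s\<bar> + \<bar>t\<bar>)\<^sup>2" by (simp add: w_def sum_distrib_right)
      also have "(\<bar>s\<bar> + \<bar>t\<bar>)\<^sup>2 = s\<^sup>2 + 2 * \<bar>s * t\<bar> + t\<^sup>2"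
        by (simp add: power2_sum abs_mult)
      finally show ?thesis .
    qed
    have "0 < ((l - N + a) * s\<^sup>2 + (l\<^sup>2 - l - N - b) * t\<^sup>2 - 2 * (\<bar>N - 2 * d\<bar> + b) * \<bar>s * t\<bar>) / l"
      using binary_form_pos[OF pd(1,2), of s t] pd(3) False l by simp
    also have "\<dots> \<le> ((l - N + a) * s\<^sup>2 + (l\<^sup>2 - l - N - b) * t\<^sup>2 - 2 * b * \<bar>s * t\<bar> - 2 * (N - 2 * d) * (s * t)) / l"
    proof -
      have "(N - 2 * d) * (s * t) \<le> \<bar>N - 2 * d\<bar> * \<bar>s * t\<bar>" by (simp add: abs_mult[symmetric])
      then show ?thesis using l by (intro divide_right_mono) (auto simp: algebra_simps)
    qed
    also have "\<dots> = s\<^sup>2 + (l - 1) * t\<^sup>2 - (d * (s - t)\<^sup>2 + (N - d) * (s + t)\<^sup>2) / l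
      + 2 / l\<^sup>2 * (2 * real m * (s\<^sup>2 - 2 * \<bar>s * t\<bar> - t\<^sup>2)) - 36 / 7 / l ^ 3 * (w * (s\<^sup>2 + 2 * \<bar>s * t\<bar> + t\<^sup>2))"
      using l by (simp add: a b Kw field_simps power2_eq_square power3_eq_cube)
    also have "\<dots> \<le> s\<^sup>2 + (l - 1) * t\<^sup>2 - (d * (s - t)\<^sup>2 + (N - d) * (s + t)\<^sup>2) / l
      + 2 / l\<^sup>2 * (\<Sum>(i, j)\<in>avoid E v. u i * u j)
      - 36 / 7 / l ^ 3 * (\<Sum>i\<in>V - {v}. (\<Sum>j\<in>avoid E v `` {i}. u j)\<^sup>2)"
      using uu gg l by (intro diff_mono add_mono order.refl mult_left_mono) auto
    also have "\<dots> \<le> l * (\<Sum>i\<in>V. (x i)\<^sup>2) - qform V E x"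
      using qform_hub_bound[OF v l m, of x] unfolding u_def s_def t_def N d by simp
    finally show ?thesis by simp
  qed
qed

text \<open>
A non-isolated vertex that is neither the hub nor one of its neighbours lies on an edge off the hub. This bounds
from below the number of vertices met by the edges off the hub.
\<close>

lemma card_Field_le: "card (Field E) \<le> 1 + deg E v + card (Field (avoid E v))"
proof -
  interpret D: arc_graph "V - {v}" "avoid E v" by (rule arc_graph_avoid)
  have "finite (Field (avoid E v))" using D.finite_E by (rule finite_Field)
  moreover have "Field E \<subseteq> insert v (E `` {v} \<union> Field (avoid E v))"
    using E_symD by (auto simp: Field_def avoid_def)
  ultimately have "card (Field E) \<le> card (insert v (E `` {v} \<union> Field (avoid E v)))"
    using finite_nbrs[of v] by (intro card_mono) auto
  also have "\<dots> \<le> 1 + card (E `` {v} \<union> Field (avoid E v))"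
    by (simp add: card_insert_le_m1 card_insert_if)
  also have "\<dots> \<le> 1 + (card (E `` {v}) + card (Field (avoid E v)))" using card_Un_le by auto
  finally show ?thesis by (simp add: deg_def)
qed

lemma qform_lt_level_of_three_off_hub:
  fixes x :: "'a \<Rightarrow> real" and l :: real
  assumes v: "v \<in> V" and max: "\<And>i. deg E i \<le> deg E v"
    and E: "card E = 2 * (m + deg E v)" and F: "card (Field E) = m + deg E v - 1"
    and sz: "3 \<le> m" "3 \<le> deg E v" "15 \<le> m + deg E v" "m + deg E v + 20 \<le> card V"
    and l: "real (card V - 1) - 1/4 \<le> l" "l \<le> real (card V - 1) + 1"
    and root: "level_poly (real (card V - 1)) (real (m + deg E v - 2)) l = 0"
    and x: "\<exists>i\<in>V. x i \<noteq> 0"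
  shows "qform V E x < l * (\<Sum>i\<in>V. (x i)\<^sup>2)"
proof -
  interpret D: arc_graph "V - {v}" "avoid E v" by (rule arc_graph_avoid)
  define d where "d = deg E v"
  define N where "N = real (card V - 1)"
  define w where "w = (\<Sum>i\<in>V - {v}. (deg (avoid E v) i)\<^sup>2)"
  have m: "card (avoid E v) = 2 * m" using card_avoid[of v] E by simp
  have N': "34 \<le> N" "real m + real d + 19 \<le> N" using sz by (auto simp: N_def d_def)
  have l33: "33 \<le> l" using N' l by (simp add: N_def)
  have l2: "1089 \<le> l\<^sup>2" using mult_mono[of 33 l 33 l] l33 by (simp add: power2_eq_square)
  \<comment> \<open>\<open>n \<ge> k + 20\<close> gives \<open>m + 21 \<le> l\<close>, and \<open>(m + 21)\<^sup>2 \<ge> 81 * m\<close> for every \<open>m\<close>\<close>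
  have m81: "81 * real m \<le> l\<^sup>2"
  proof -
    have "real m + 21 \<le> l" using N' l sz by (simp add: N_def d_def)
    then have "(real m + 21)\<^sup>2 \<le> l\<^sup>2" by (intro power_mono) auto
    moreover have "81 * real m \<le> (real m + 21)\<^sup>2"
      using zero_le_power2[of "real m - 20"] by (simp add: power2_eq_square algebra_simps)
    ultimately show ?thesis by linarith
  qed
  obtain p where p: "p \<in> V - {v}" "\<And>i. deg (avoid E v) i \<le> deg (avoid E v) p"
  proof -
    have "V - {v} \<noteq> {}"
    proof
      assume "V - {v} = {}"
      then have "card V \<le> card {v}" by (intro card_mono) auto
      then show False using sz by simp
    qed
    then show thesis using D.max_degree_vertex that by blast
  qed
  define D where "D = deg (avoid E v) p"
  have D1: "1 \<le> D"
  proof (rule ccontr)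
    assume "\<not> 1 \<le> D"
    then have "deg (avoid E v) i = 0" for i using p(2)[of i] by (simp add: D_def)
    then have "card (avoid E v) = 0" using D.sum_deg by simp
    then show False using m sz by simp
  qed
  have Dm: "D \<le> m" using D.deg_le[of p] m by (simp add: D_def)
  have Dd: "D \<le> d" using deg_avoid[of p v] max[of p] p(1) by (simp add: D_def d_def)
  have f: "w \<le> D\<^sup>2 + D + (m - D)\<^sup>2 + 5 * (m - D)"
    unfolding w_def D_def using D.sum_deg_sq_le_vertex[OF m p(1)] .
  have g: "w + D * (m - 2) \<le> (D + 1) * (2 * m)"
  proof -
    have "m - 2 \<le> card (Field (avoid E v))" using card_Field_le[of v] F by simp
    then have "D * (m - 2) \<le> D * card (Field (avoid E v))" by simp
    moreover have "w + D * card (Field (avoid E v)) \<le> (D + 1) * (2 * m)"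
      using D.sum_deg_sq_le_max[of D] p(2) m by (simp add: w_def D_def)
    ultimately show ?thesis by linarith
  qed
  define K where "K = 36 / 7 * real w"
  have key: "K < 4 * (real m - 2) * (2 * real d + real m - 9 / 4) + 22 - 161 / 10 * real m"
    unfolding K_def using degree_budget[OF _ _ _ D1 Dm Dd f g] sz by (simp add: d_def)
  have root': "l\<^sup>2 * (l - 1 - N + 8 * (l - 3) / (l\<^sup>2 - 8)) + 4 * ((real d + real m - 2) - 8 * (l - 3) / (l\<^sup>2 - 8)) * (N - (real d + real m - 2)) = 0"
  proof -
    have "real (m + deg E v - 2) = real d + real m - 2" using sz by (simp add: d_def of_nat_diff)
    then show ?thesis using level_poly_root[OF root] l2 by (simp add: N_def)
  qed
  have K0: "0 \<le> K" by (simp add: K_def)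
  have pd: "(\<bar>N - 2 * real d\<bar> + (4 * real m / l + K / l\<^sup>2))\<^sup>2 < (l - N + (4 * real m / l - K / l\<^sup>2)) * (l\<^sup>2 - l - N - (4 * real m / l + K / l\<^sup>2))"
    "0 < l\<^sup>2 - l - N - (4 * real m / l + K / l\<^sup>2)" "0 \<le> 4 * real m / l + K / l\<^sup>2"
    using secular_gap[OF N'(1) _ _ N'(2) _ _ K0 key refl root' refl refl] sz l by (auto simp: N_def d_def)
  show ?thesis
    by (rule qform_lt_of_secular_gap[OF v _ m m81 N_def _ _ refl refl pd x])
      (use l33 in \<open>auto simp: K_def w_def d_def\<close>)
qed

end

section \<open>Graphs with two edges off the hub\<close>

text \<open>
The root equation of the level says that the binary form of the extremal graph is singular.
\<close>

lemma level_form: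
  fixes N d l s t R :: real
  assumes R: "R = 8 * (l - 3) / (l\<^sup>2 - 8)"
    and root: "l\<^sup>2 * (l - 1 - N + R) + 4 * (d - R) * (N - d) = 0"
  shows "(l - N + R) * (l\<^sup>2 - l - N + R) = (N - 2 * d + R)\<^sup>2"
  using root by (simp add: algebra_simps power2_eq_square)

text \<open>
For the hub degree \<open>d = k - 2\<close>, the assumption \<open>det\<close> says that \<open>l\<close> solves the secular equation of the
extremal graph.
\<close>

locale level_bounds =
  fixes N d l R :: real
  assumes N34: "34 \<le> N" and d0: "0 \<le> d" and l_lower: "N - 1/4 \<le> l" and l_upper: "l \<le> N + 1"
    and R: "R = 8 * (l - 3) / (l\<^sup>2 - 8)"
    and det: "(l - N + R) * (l\<^sup>2 - l - N + R) = (N - 2 * d + R)\<^sup>2"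
begin

lemma l33: "33 \<le> l" using N34 l_lower by linarith

lemma l2: "33 * l \<le> l\<^sup>2" using l33 by (simp add: power2_eq_square)

lemma R_nonneg: "0 \<le> R" using l33 l2 by (simp add: R)

lemma R_upper: "l\<^sup>2 * R \<le> 8 * l - 22"
proof -
  have "33 * l \<le> l * l" using l33 by simp
  then have "l\<^sup>2 * (8 * (l - 3)) \<le> (8 * l - 22) * (l\<^sup>2 - 8)"
    using l33 by (simp only: algebra_simps power2_eq_square)
  then show ?thesis using l33 l2 by (simp add: R field_simps)
qed

lemma beta_pos: "0 < l\<^sup>2 - l - N + R"
  using l2 l33 l_lower R_nonneg by linarith

text \<open>
The binary form of the extremal graph: the edges at the hub contribute as in \<open>qform_hub_expansion\<close>,
and \<open>R * (s - t)\<^sup>2 / l\<close> is the exact contribution of the path off the hub.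
\<close>

definition form :: "real \<Rightarrow> real \<Rightarrow> real" where
  "form s t = s\<^sup>2 + (l - 1) * t\<^sup>2 - (d * (s - t)\<^sup>2 + (N - d) * (s + t)\<^sup>2) / l + R * (s - t)\<^sup>2 / l"

lemma form_eq: "l * form s t = (l - N + R) * s\<^sup>2 + (l\<^sup>2 - l - N + R) * t\<^sup>2 - 2 * (N - 2 * d + R) * (s * t)"
  using l33 by (simp add: form_def field_simps power2_eq_square)

lemma form_nonneg: "0 \<le> form s t"
proof -
  have "(l\<^sup>2 - l - N + R) * (l * form s t) = ((l\<^sup>2 - l - N + R) * t - (N - 2 * d + R) * s)\<^sup>2 
     + ((l - N + R) * (l\<^sup>2 - l - N + R) - (N - 2 * d + R)\<^sup>2) * s\<^sup>2"
    unfolding form_eq by (simp add: algebra_simps power2_eq_square)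
  also have "\<dots> \<ge> 0" by (simp add: det)
  finally have "0 \<le> (l\<^sup>2 - l - N + R) * (l * form s t)" .
  then show ?thesis using beta_pos l33 by (simp add: zero_le_mult_iff)
qed

lemma form_diagonal: "0 < form s s" if "s \<noteq> 0"
proof -
  have "l * form s s = (l\<^sup>2 - 4 * N + 4 * d) * s\<^sup>2"
    unfolding form_eq by (simp add: algebra_simps power2_eq_square)
  moreover have "0 < l\<^sup>2 - 4 * N + 4 * d" using l2 l33 l_lower d0 N34 by linarith
  ultimately have "0 < l * form s s" using that by simp
  then show ?thesis using l33 by (simp add: zero_less_mult_iff)
qed

text \<open>
The left-hand side of \<open>qform_hub_bound\<close> for two disjoint edges off the hub. It exceeds \<open>form\<close> by a multiple
of \<open>(s - t)\<^sup>2\<close> with the sign of \<open>8 * l - l\<^sup>2 * R - 144 / 7\<close>, and \<open>8 * l - l\<^sup>2 * R \<ge> 22\<close>. Where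
\<open>s = t \<noteq> 0\<close>, \<open>form\<close> itself is positive.
\<close>

lemma form_slack:
  assumes "s \<noteq> 0 \<or> t \<noteq> 0"
  shows "0 < s\<^sup>2 + (l - 1) * t\<^sup>2 - (d * (s - t)\<^sup>2 + (N - d) * (s + t)\<^sup>2) / l
     + 2 / l\<^sup>2 * (4 * (s - t)\<^sup>2) - 36 / 7 / l ^ 3 * (4 * (s - t)\<^sup>2)"
proof -
  have eq: "s\<^sup>2 + (l - 1) * t\<^sup>2 - (d * (s - t)\<^sup>2 + (N - d) * (s + t)\<^sup>2) / l
     + 2 / l\<^sup>2 * (4 * (s - t)\<^sup>2) - 36 / 7 / l ^ 3 * (4 * (s - t)\<^sup>2)
     = form s t + (8 * l - l\<^sup>2 * R - 144 / 7) / l ^ 3 * (s - t)\<^sup>2"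
  proof -
    have "R * (s - t)\<^sup>2 / l = l\<^sup>2 * R / l ^ 3 * (s - t)\<^sup>2" using l33 by (simp add: field_simps power2_eq_square power3_eq_cube)
    moreover have "2 / l\<^sup>2 * (4 * (s - t)\<^sup>2) = 8 * l / l ^ 3 * (s - t)\<^sup>2" using l33 by (simp add: field_simps power2_eq_square power3_eq_cube)
    ultimately show ?thesis unfolding form_def by (simp add: diff_divide_distrib left_diff_distrib)
  qed
  have pos: "0 < (8 * l - l\<^sup>2 * R - 144 / 7) / l ^ 3" using R_upper l33 by simp
  show ?thesis
  proof (cases "s = t")
    case True then show ?thesis unfolding eq using form_diagonal[of s] assms by simp
  next
    case False
    then have "0 < (8 * l - l\<^sup>2 * R - 144 / 7) / l ^ 3 * (s - t)\<^sup>2" using pos by (intro mult_pos_pos) auto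
    then show ?thesis unfolding eq using form_nonneg[of s t] by linarith
  qed
qed

text \<open>
The exact minimum over the three coordinates on the path, in place of the estimate in
\<open>qform_hub_bound\<close>: with \<open>c\<close> the middle vertex, the right-hand side is minimised where \<open>A\<close>, \<open>B\<close> and
\<open>G\<close> in the proof vanish.
\<close>

lemma path_resolvent_bound:
  fixes a b c \<sigma> :: real
  shows "R * \<sigma>\<^sup>2 / l - 8 * \<sigma>\<^sup>2 / l\<^sup>2 \<le> l * (a\<^sup>2 + b\<^sup>2 + c\<^sup>2) + 4 / l * (\<sigma> * (2 * c + a + b)) + 4 * c * (a + b)"
proof -
  define q where "q = l\<^sup>2 - 8"
  define p where "p = \<sigma> / (l * q)"
  have q: "q > 0" using l33 l2 by (simp add: q_def)
  have s: "\<sigma> = p * l * q" using q l33 by (simp add: p_def)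
  have Rq: "R = 8 * (l - 3) / q" by (simp add: R q_def)
  define A where "A = a - (8 - 2 * l) * p"
  define B where "B = b - (8 - 2 * l) * p"
  define G where "G = c - (8 - 4 * l) * p"
  have "0 \<le> (l - 4) * (A\<^sup>2 + B\<^sup>2 + G\<^sup>2) + 2 * (A + G)\<^sup>2 + 2 * (B + G)\<^sup>2 + 2 * A\<^sup>2 + 2 * B\<^sup>2"
    using l33 by (intro add_nonneg_nonneg mult_nonneg_nonneg) auto
  also have "\<dots> = l * (a\<^sup>2 + b\<^sup>2 + c\<^sup>2) + 4 * p * q * (2 * c + a + b) + 4 * c * (a + b) + (24 * l - 64) * p\<^sup>2 * q"
    unfolding A_def B_def G_def q_def by (simp add: algebra_simps power2_eq_square power3_eq_cube)
  finally have "- ((24 * l - 64) * p\<^sup>2 * q) \<le> l * (a\<^sup>2 + b\<^sup>2 + c\<^sup>2) + 4 * p * q * (2 * c + a + b) + 4 * c * (a + b)"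
    by linarith
  moreover have "R * \<sigma>\<^sup>2 / l - 8 * \<sigma>\<^sup>2 / l\<^sup>2 = - ((24 * l - 64) * p\<^sup>2 * q)"
  proof -
    have "R * \<sigma>\<^sup>2 / l = 8 * (l - 3) * l * p\<^sup>2 * q" using q l33 by (simp add: Rq s field_simps power2_eq_square)
    moreover have "8 * \<sigma>\<^sup>2 / l\<^sup>2 = 8 * (l\<^sup>2 - 8) * p\<^sup>2 * q" using l33 unfolding q_def[symmetric] by (simp add: s field_simps power2_eq_square)
    ultimately show ?thesis by (simp add: algebra_simps power2_eq_square)
  qed
  moreover have "4 / l * (\<sigma> * (2 * c + a + b)) = 4 * p * q * (2 * c + a + b)" using l33 by (simp add: s)
  ultimately show ?thesis by linarith
qed

end

text \<open>
The two ways in which two edges can lie: sharing the vertex \<open>c\<close>, or disjoint.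
\<close>

definition path_arcs :: "'a \<Rightarrow> 'a \<Rightarrow> 'a \<Rightarrow> ('a \<times> 'a) set" where
  "path_arcs a c b = {(a, c), (c, a), (c, b), (b, c)}"

definition matching_arcs :: "'a \<Rightarrow> 'a \<Rightarrow> 'a \<Rightarrow> 'a \<Rightarrow> ('a \<times> 'a) set" where
  "matching_arcs a b c e = {(a, b), (b, a), (c, e), (e, c)}"

context arc_graph begin

lemma qform_lt_level_matching:
  fixes x :: "'a \<Rightarrow> real" and l R :: real
  assumes v: "v \<in> V" and lb: "level_bounds (real (card V - 1)) (real (deg E v)) l R"
    and rest: "avoid E v = matching_arcs a b c e" and dist: "distinct [a, b, c, e]"
    and nbr: "{a, b, c, e} \<subseteq> E `` {v}"
    and x: "\<exists>i\<in>V. x i \<noteq> 0"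
  shows "qform V E x < l * (\<Sum>i\<in>V. (x i)\<^sup>2)"
proof -
  interpret L: level_bounds "real (card V - 1)" "real (deg E v)" l R by (rule lb)
  interpret D: arc_graph "V - {v}" "avoid E v" by (rule arc_graph_avoid)
  have l0: "l > 0" using L.l33 by simp
  have m: "card (avoid E v) = 2 * 2" using dist by (auto simp: rest matching_arcs_def)
  have m81: "81 * real 2 \<le> l\<^sup>2" using L.l33 L.l2 by simp
  define t where "t = x v"
  define s where "s = (\<Sum>i\<in>V - {v}. x i)"
  show ?thesis
  proof (cases "s = 0 \<and> t = 0")
    case True
    then show ?thesis using qform_hub_zero[OF v l0 m m81] x by (simp add: s_def t_def)
  next
    case False
    define u where "u i = (if (v, i) \<in> E then s - t else s + t)" for i
    have un: "u a = s - t" "u b = s - t" "u c = s - t" "u e = s - t" using nbr by (auto simp: u_def)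
    have uu: "(\<Sum>(i, j)\<in>avoid E v. u i * u j) = 4 * (s - t)\<^sup>2"
      using dist by (simp add: rest matching_arcs_def un power2_eq_square)
    have gg: "(\<Sum>i\<in>V - {v}. (\<Sum>j\<in>avoid E v `` {i}. u j)\<^sup>2) = 4 * (s - t)\<^sup>2"
    proof -
      have im: "avoid E v `` {i} = (if i = a then {b} else if i = b then {a} else if i = c then {e} else if i = e then {c} else {})" for i
        using dist by (auto simp: rest matching_arcs_def)
      have sub: "{a, b, c, e} \<subseteq> V - {v}" using D.E_sub by (auto simp: rest matching_arcs_def)
      have "(\<Sum>i\<in>V - {v}. (\<Sum>j\<in>avoid E v `` {i}. u j)\<^sup>2) = (\<Sum>i\<in>{a, b, c, e}. (\<Sum>j\<in>avoid E v `` {i}. u j)\<^sup>2)"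
        using sub finite_V im by (intro sum.mono_neutral_right) auto
      then show ?thesis using dist by (simp add: im un)
    qed
    show ?thesis
      using qform_hub_bound[OF v l0 m m81, of x] L.form_slack[of s t] False uu gg
      unfolding u_def s_def t_def by simp
  qed
qed

lemma qform_le_level_path:
  fixes x :: "'a \<Rightarrow> real" and l R :: real
  assumes v: "v \<in> V" and lb: "level_bounds (real (card V - 1)) (real (deg E v)) l R"
    and rest: "avoid E v = path_arcs a c b" and dist: "distinct [a, b, c]"
    and nbr: "{a, b, c} \<subseteq> E `` {v}"
  shows "qform V E x \<le> l * (\<Sum>i\<in>V. (x i)\<^sup>2)"
proof -
  interpret L: level_bounds "real (card V - 1)" "real (deg E v)" l R by (rule lb)
  interpret D: arc_graph "V - {v}" "avoid E v" by (rule arc_graph_avoid)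
  have l0: "l > 0" using L.l33 by simp
  define t where "t = x v"
  define s where "s = (\<Sum>i\<in>V - {v}. x i)"
  define u where "u i = (if (v, i) \<in> E then s - t else s + t)" for i
  define z where "z i = x i - u i / l" for i
  have un: "u a = s - t" "u b = s - t" "u c = s - t" using nbr by (auto simp: u_def)
  have uu: "(\<Sum>(i, j)\<in>avoid E v. u i * u j) = 4 * (s - t)\<^sup>2"
    using dist by (simp add: rest path_arcs_def un power2_eq_square)
  have zz: "(\<Sum>(i, j)\<in>avoid E v. z i * z j) = 2 * z c * (z a + z b)"
    using dist by (simp add: rest path_arcs_def algebra_simps)
  have sub: "{a, b, c} \<subseteq> V - {v}" using D.E_sub by (auto simp: rest path_arcs_def)
  have zg: "(\<Sum>i\<in>V - {v}. z i * (\<Sum>j\<in>avoid E v `` {i}. u j)) = (s - t) * (2 * z c + z a + z b)"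
  proof -
    have im: "avoid E v `` {i} = (if i = a then {c} else if i = b then {c} else if i = c then {a, b} else {})" for i
      using dist by (auto simp: rest path_arcs_def)
    have ia: "avoid E v `` {a} = {c}" "avoid E v `` {b} = {c}" "avoid E v `` {c} = {a, b}"
      using dist by (auto simp: rest path_arcs_def)
    have "(\<Sum>i\<in>V - {v}. z i * (\<Sum>j\<in>avoid E v `` {i}. u j)) = (\<Sum>i\<in>{a, b, c}. z i * (\<Sum>j\<in>avoid E v `` {i}. u j))"
      using sub finite_V im by (intro sum.mono_neutral_right) auto
    also have "\<dots> = (s - t) * (2 * z c + z a + z b)"
      using dist ia by (simp add: un algebra_simps)
    finally show ?thesis .
  qed
  have z2: "(z a)\<^sup>2 + (z b)\<^sup>2 + (z c)\<^sup>2 \<le> (\<Sum>i\<in>V - {v}. (z i)\<^sup>2)"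
  proof -
    have "(\<Sum>i\<in>{a, b, c}. (z i)\<^sup>2) \<le> (\<Sum>i\<in>V - {v}. (z i)\<^sup>2)"
      using sub finite_V by (intro sum_mono2) auto
    then show ?thesis using dist by (simp add: add.assoc)
  qed
  have "R * (s - t)\<^sup>2 / l - 8 * (s - t)\<^sup>2 / l\<^sup>2
    \<le> l * ((z a)\<^sup>2 + (z b)\<^sup>2 + (z c)\<^sup>2) + 4 / l * ((s - t) * (2 * z c + z a + z b)) + 4 * z c * (z a + z b)"
    by (rule L.path_resolvent_bound)
  also have "\<dots> \<le> l * (\<Sum>i\<in>V - {v}. (z i)\<^sup>2) + 4 / l * ((s - t) * (2 * z c + z a + z b)) + 2 * (2 * z c * (z a + z b))"
    using z2 l0 by simp
  finally have "L.form s t \<le> l * (\<Sum>i\<in>V. (x i)\<^sup>2) - qform V E x"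
    using qform_hub_expansion[OF v, of l x] l0 uu zz zg
    unfolding u_def z_def s_def t_def L.form_def by simp
  then show ?thesis using L.form_nonneg[of s t] by linarith
qed

text \<open>
The eigenvector follows the completion of squares backwards: \<open>(s, t)\<close> spans the kernel of the singular
binary form, and the remaining coordinates minimise for these \<open>s\<close> and \<open>t\<close>. The choice
\<open>s = l\<^sup>2 - l - N + R\<close> keeps \<open>s\<close> positive, whereas \<open>t = N - 2 * d + R\<close> may vanish or be negative.
\<close>

lemma path_eigenvector:
  assumes v: "v \<in> V" and lb: "level_bounds (real (card V - 1)) (real (deg E v)) l R"
    and rest: "avoid E v = path_arcs a c b" and dist: "distinct [a, b, c]"
    and nbr: "{a, b, c} \<subseteq> E `` {v}"
  obtains x where "\<exists>i\<in>V. x i \<noteq> 0" "\<And>i. i \<in> V \<Longrightarrow> (\<Sum>j\<in>V. x j) - 2 * (\<Sum>j\<in>E `` {i}. x j) = l * x i"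
proof -
  define N where "N = real (card V - 1)"
  define d where "d = real (deg E v)"
  interpret L: level_bounds N d l R using lb by (simp add: N_def d_def)
  define s where "s = l\<^sup>2 - l - N + R"
  define t where "t = N - 2 * d + R"
  define q where "q = l\<^sup>2 - 8"
  have s0: "s > 0" using L.beta_pos by (simp add: s_def)
  have l0: "l > 0" using L.l33 by simp
  have q0: "q > 0" using L.l33 L.l2 by (simp add: q_def)
  have qR: "q * R = 8 * (l - 3)" using q0 by (simp add: L.R q_def)
  have ns: "(l - N + R) * s = t * t" using L.det by (simp add: s_def t_def power2_eq_square)
  define x where "x i = (if i = v then t else if i = c then (s - t) * (l - 4) / q
     else if i = a \<or> i = b then (s - t) * (l - 2) / q else if (v, i) \<in> E then (s - t) / l else (s + t) / l)" for i
  have nv: "(v, v) \<notin> E" using E_irreflD by auto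
  have cs: "c \<noteq> v" "a \<noteq> v" "b \<noteq> v" using nbr nv by auto
  have xs: "x v = t" "x c = (s - t) * (l - 4) / q" "x a = (s - t) * (l - 2) / q" "x b = (s - t) * (l - 2) / q"
    using dist cs by (auto simp: x_def)
  define y where "y = (s - t) / q"
  have yq: "s = t + y * q" using q0 by (simp add: y_def)
  have ys: "x v = t" "x c = y * (l - 4)" "x a = y * (l - 2)" "x b = y * (l - 2)"
    by (simp_all add: xs y_def)
  define C where "C = E `` {v}"
  have C: "finite C" "C \<subseteq> V - {v}" "{a, b, c} \<subseteq> C" using finite_nbrs nbrs_sub nv nbr by (auto simp: C_def)
  have dC: "d = real (card C)" by (simp add: d_def C_def deg_def)
  have SC: "(\<Sum>j\<in>C. x j) = (d - R) * (s - t) / l"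
  proof -
    have "(\<Sum>j\<in>C. x j) = (\<Sum>j\<in>{a, b, c}. x j) + (\<Sum>j\<in>C - {a, b, c}. x j)"
      using sum.subset_diff[OF C(3) C(1), of x] by simp
    also have "(\<Sum>j\<in>C - {a, b, c}. x j) = (\<Sum>j\<in>C - {a, b, c}. (s - t) / l)"
      by (intro sum.cong) (auto simp: x_def C_def nv)
    also have "\<dots> = (d - 3) * ((s - t) / l)"
    proof -
      have "card (C - {a, b, c}) = card C - 3" using C dist by (simp add: card_Diff_subset)
      moreover have "3 \<le> card C" using card_mono[OF C(1) C(3)] dist by simp
      ultimately show ?thesis by (simp add: dC of_nat_diff)
    qed
    also have "(\<Sum>j\<in>{a, b, c}. x j) = (s - t) * ((3 * l - 8) / q)"
      using dist by (simp add: xs add_divide_distrib[symmetric] algebra_simps)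
    also have "(3 * l - 8) / q = (3 - R) / l"
      using q0 l0 qR by (simp add: field_simps q_def power2_eq_square)
    also have "(s - t) * ((3 - R) / l) + (d - 3) * ((s - t) / l) = (d - R) * (s - t) / l"
      using l0 by (simp add: field_simps)
    finally show ?thesis .
  qed
  have SO: "(\<Sum>j\<in>V - {v} - C. x j) = (N - d) * (s + t) / l"
  proof -
    have "(\<Sum>j\<in>V - {v} - C. x j) = (\<Sum>j\<in>V - {v} - C. (s + t) / l)"
      using C by (intro sum.cong) (auto simp: x_def C_def)
    also have "\<dots> = real (card (V - {v} - C)) * ((s + t) / l)" by simp
    also have "card (V - {v} - C) = card V - 1 - card C"
      using C v finite_V by (simp add: card_Diff_subset)
    also have "real (card V - 1 - card C) = N - d"
    proof -
      have "card C \<le> card V - 1" using card_mono[OF _ C(2)] finite_V v by simp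
      then show ?thesis by (simp add: N_def dC of_nat_diff)
    qed
    finally show ?thesis by simp
  qed
  have SY: "(\<Sum>j\<in>V - {v}. x j) = s"
  proof -
    have "(\<Sum>j\<in>V - {v}. x j) = (\<Sum>j\<in>C. x j) + (\<Sum>j\<in>V - {v} - C. x j)"
      using C finite_V by (simp add: sum.subset_diff add.commute)
    also have "\<dots> = ((d - R) * (s - t) + (N - d) * (s + t)) / l"
      by (simp only: SC SO add_divide_distrib)
    also have "(d - R) * (s - t) + (N - d) * (s + t) = l * s"
    proof -
      have "(d - R) * (s - t) + (N - d) * (s + t) = (N - R) * s + (N - 2 * d + R) * t" by (simp add: algebra_simps)
      also have "\<dots> = (N - R) * s + (l - N + R) * s" unfolding ns by (simp add: t_def)
      also have "\<dots> = l * s" by (simp add: algebra_simps)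
      finally show ?thesis .
    qed
    finally show ?thesis using l0 by simp
  qed
  have S: "(\<Sum>j\<in>V. x j) = s + t" using finite_V v SY by (simp add: sum.remove xs)
  show thesis
  proof (rule that)
    show "\<exists>i\<in>V. x i \<noteq> 0"
    proof (rule ccontr)
      assume "\<not> (\<exists>i\<in>V. x i \<noteq> 0)"
      then have "t = 0" "(\<Sum>j\<in>V. x j) = 0" using v xs(1) by auto
      then show False using S s0 by simp
    qed
    fix i assume i: "i \<in> V"
    have im: "E `` {i} = (if i = v then C else (if (v, i) \<in> E then {v} else {}) \<union> avoid E v `` {i})"
      using E_symD by (auto simp: C_def avoid_def)
    consider "i = v" | "i = c" | "i = a \<or> i = b" | "i \<noteq> v" "i \<notin> {a, b, c}" "(v, i) \<in> E" | "i \<noteq> v" "i \<notin> {a, b, c}" "(v, i) \<notin> E"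
      by auto
    then show "(\<Sum>j\<in>V. x j) - 2 * (\<Sum>j\<in>E `` {i}. x j) = l * x i"
    proof cases
      case 1
      have "l * ((s + t) - 2 * ((d - R) * (s - t) / l)) = l * (l * t)"
      proof -
        have "l * ((s + t) - 2 * ((d - R) * (s - t) / l)) = l * s + l * t - 2 * (d - R) * (s - t)"
          using l0 by (simp add: field_simps)
        also have "l * s = (N - R) * s + (N - 2 * d + R) * t" using ns by (simp add: t_def algebra_simps)
        also have "(N - R) * s + (N - 2 * d + R) * t + l * t - 2 * (d - R) * (s - t) = t * s + (N - R + l) * t"
          by (simp add: t_def algebra_simps)
        also have "\<dots> = l * (l * t)" by (simp add: s_def algebra_simps power2_eq_square)
        finally show ?thesis .
      qed
      then show ?thesis using 1 l0 im by (simp add: S SC xs)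
    next
      case 2
      then have "E `` {i} = {v, a, b}" using im nbr cs dist by (auto simp: rest path_arcs_def)
      then have "(\<Sum>j\<in>E `` {i}. x j) = t + 2 * (y * (l - 2))" using dist cs by (simp add: ys)
      then show ?thesis unfolding S 2 ys(2) using yq by (simp add: q_def algebra_simps power2_eq_square)
    next
      case 3
      then have "E `` {i} = {v, c}" using im nbr cs dist by (auto simp: rest path_arcs_def)
      then have n: "(\<Sum>j\<in>E `` {i}. x j) = t + y * (l - 4)" using dist cs by (simp add: ys)
      have xi: "x i = y * (l - 2)" using 3 ys by auto
      show ?thesis unfolding S n xi using yq by (simp add: q_def algebra_simps power2_eq_square)
    next
      case 4
      then have "E `` {i} = {v}" using im by (auto simp: rest path_arcs_def)
      moreover have "x i = (s - t) / l" using 4 by (auto simp: x_def)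
      ultimately show ?thesis using l0 by (simp add: S xs(1))
    next
      case 5
      then have "E `` {i} = {}" using im by (auto simp: rest path_arcs_def)
      moreover have "x i = (s + t) / l" using 5 by (auto simp: x_def)
      ultimately show ?thesis using l0 by (simp add: S)
    qed
  qed
qed

end

section \<open>The dichotomy for negative edge sets\<close>

text \<open>
A hub \<open>v\<close> joined to all of \<open>C\<close>, and a path with middle vertex \<open>c\<close> inside \<open>C\<close>. For
\<open>card C = r + 3\<close> these are the arcs of a copy of \<open>\<theta>\<^sub>2(0, r)\<close>.
\<close>

definition theta_arcs :: "'a \<Rightarrow> 'a set \<Rightarrow> 'a \<Rightarrow> 'a \<Rightarrow> 'a \<Rightarrow> ('a \<times> 'a) set" where
  "theta_arcs v C a c b = {v} \<times> C \<union> C \<times> {v} \<union> path_arcs a c b"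

definition theta_type :: "nat \<Rightarrow> ('a \<times> 'a) set \<Rightarrow> bool" where
  "theta_type r E \<longleftrightarrow> (\<exists>v C a c b. finite C \<and> card C = r + 3 \<and> v \<notin> C \<and> {a, c, b} \<subseteq> C \<and> distinct [a, b, c]
     \<and> E = theta_arcs v C a c b)"

context arc_graph begin

lemma two_edges_cases:
  assumes "card E = 4"
  obtains a c b where "distinct [a, b, c]" "E = path_arcs a c b"
  | a b c e where "distinct [a, b, c, e]" "E = matching_arcs a b c e"
proof -
  have "E \<noteq> {}" using assms by auto
  then obtain a b where ab: "(a, b) \<in> E" by auto
  then have ab': "(b, a) \<in> E" "a \<noteq> b" using E_symD E_irreflD by auto
  have "card (E - {(a, b), (b, a)}) = 2"
    using assms ab ab' finite_E by (simp add: card_Diff_subset)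
  then have "E - {(a, b), (b, a)} \<noteq> {}" by (metis card.empty zero_neq_numeral)
  then obtain c e where ce: "(c, e) \<in> E" "(c, e) \<noteq> (a, b)" "(c, e) \<noteq> (b, a)" by auto
  then have ce': "(e, c) \<in> E" "c \<noteq> e" using E_symD E_irreflD by auto
  have "{(a, b), (b, a), (c, e), (e, c)} \<subseteq> E" using ab ab' ce ce' by auto
  moreover have "card {(a, b), (b, a), (c, e), (e, c)} = 4"
    using ab' ce ce' by auto
  ultimately have E: "E = {(a, b), (b, a), (c, e), (e, c)}"
    using assms finite_E by (metis card_subset_eq)
  consider "c = a" | "c = b" | "e = a" | "e = b" | "distinct [a, b, c, e]" using ab' ce' by auto
  then show thesis
  proof cases
    case 1 then show ?thesis using that(1)[of b e a] E ab' ce ce' by (auto simp: path_arcs_def)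
  next
    case 2 then show ?thesis using that(1)[of a e b] E ab' ce ce' by (auto simp: path_arcs_def)
  next
    case 3 then show ?thesis using that(1)[of b c a] E ab' ce ce' by (auto simp: path_arcs_def)
  next
    case 4 then show ?thesis using that(1)[of a c b] E ab' ce ce' by (auto simp: path_arcs_def)
  next
    case 5 then show ?thesis using that(2)[of a b c e] E by (auto simp: matching_arcs_def)
  qed
qed

lemma arcs_hub: "E = {v} \<times> (E `` {v}) \<union> (E `` {v}) \<times> {v} \<union> avoid E v"
  using E_symD by (auto simp: avoid_def)

text \<open>
A hub of degree at most \<open>2\<close> is impossible because \<open>2 * k\<close> is the sum of \<open>k - 1\<close> degrees, and its degree
is at most \<open>k - 2\<close> because only \<open>k - 1\<close> vertices carry edges. So either three or more
edges avoid the hub, or exactly two do and they span a path or a matching.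
\<close>

lemma theta_or_below_level:
  assumes k: "15 \<le> k" and E: "card E = 2 * k" and F: "card (Field E) = k - 1" and V: "k + 20 \<le> card V"
    and l: "real (card V - 1) - 1/4 \<le> l" "l \<le> real (card V - 1) + 1"
    and root: "level_poly (real (card V - 1)) (real (k - 2)) l = 0"
    and nt: "\<not> theta_type (k - 5) E" and x: "\<exists>i\<in>V. x i \<noteq> 0"
  shows "qform V E x < l * (\<Sum>i\<in>V. (x i)\<^sup>2)"
proof -
  have "V \<noteq> {}" using x by auto
  then obtain v where v: "v \<in> V" and max: "\<And>i. deg E i \<le> deg E v"
    using max_degree_vertex by blast
  define C where "C = E `` {v}"
  have fF: "finite (Field E)" using finite_E by (rule finite_Field)
  have "E \<noteq> {}" using E k by auto
  then obtain p q where "(p, q) \<in> E" by auto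
  then have "0 < deg E p" using finite_nbrs[of p] by (auto simp: deg_def card_gt_0_iff)
  then have d0: "0 < deg E v" using max[of p] by simp
  then have vF: "v \<in> Field E" by (auto simp: deg_def card_gt_0_iff Field_def)
  have CF: "C \<subseteq> Field E - {v}" using E_irreflD by (auto simp: C_def Field_def)
  have dC: "deg E v = card C" by (simp add: deg_def C_def)
  have cF: "card (Field E - {v}) = k - 2" using vF fF F by simp
  have dk: "deg E v \<le> k - 2"
    using card_mono[OF _ CF] fF cF dC by simp
  have d3: "3 \<le> deg E v"
  proof (rule ccontr)
    assume "\<not> 3 \<le> deg E v"
    have "deg E i = 0" if "i \<notin> Field E" for i
    proof -
      have "E `` {i} = {}" using that by (auto simp: Field_def)
      then show ?thesis by (simp add: deg_def)
    qed
    moreover have "Field E \<subseteq> V" using E_sub by (auto simp: Field_def)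
    ultimately have "(\<Sum>i\<in>V. deg E i) = (\<Sum>i\<in>Field E. deg E i)"
      using finite_V by (intro sum.mono_neutral_right) auto
    also have "\<dots> \<le> (\<Sum>i\<in>Field E. 2)" 
      using max \<open>\<not> 3 \<le> deg E v\<close> by (intro sum_mono) (metis le_trans not_less_eq_eq numeral_2_eq_2 numeral_3_eq_3)
    finally show False using E F k by (simp add: sum_deg)
  qed
  define m where "m = k - deg E v"
  have mk: "m + deg E v = k" using dk k by (simp add: m_def)
  show ?thesis
  proof (cases "3 \<le> m")
    case True
    then show ?thesis
      using qform_lt_level_of_three_off_hub[OF v max, of m l x] E F k V l root x d3 mk by simp
  next
    case False
    then have d: "deg E v = k - 2" using dk mk by linarith
    interpret D: arc_graph "V - {v}" "avoid E v" by (rule arc_graph_avoid)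
    have c4: "card (avoid E v) = 4" using card_avoid[of v] E d k by simp
    have CF': "C = Field E - {v}" using CF fF cF dC d by (intro card_subset_eq) auto
    have delC: "avoid E v \<subseteq> C \<times> C" unfolding CF' by (auto simp: avoid_def Field_def)
    have "l\<^sup>2 > 8" using mult_mono[of 33 l 33 l] l V k by (simp add: power2_eq_square)
    have lb: "level_bounds (real (card V - 1)) (real (deg E v)) l (8 * (l - 3) / (l\<^sup>2 - 8))"
      using k V l level_form[OF refl level_poly_root[OF root \<open>l\<^sup>2 > 8\<close>]] unfolding d
      by unfold_locales auto
    show ?thesis
    proof (rule D.two_edges_cases[OF c4])
      fix a c b assume dist: "distinct [a, b, c]" and p: "avoid E v = path_arcs a c b"
      have "{a, c, b} \<subseteq> C" using delC p by (auto simp: path_arcs_def)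
      moreover have "E = theta_arcs v C a c b"
        using arcs_hub[of v] p by (simp add: theta_arcs_def C_def)
      moreover have "card C = k - 5 + 3" "v \<notin> C" "finite C" using d dC k CF fF finite_subset by auto
      ultimately have "theta_type (k - 5) E" unfolding theta_type_def using dist by blast
      then show ?thesis using nt by simp
    next
      fix a b c e assume dist: "distinct [a, b, c, e]" and p: "avoid E v = matching_arcs a b c e"
      have "{a, b, c, e} \<subseteq> E `` {v}" using delC p by (auto simp: matching_arcs_def C_def)
      then show ?thesis by (rule qform_lt_level_matching[OF v lb p dist _ x])
    qed
  qed
qed

lemma theta_attains_level:
  assumes k: "15 \<le> k" and V: "k + 20 \<le> card V"
    and l: "real (card V - 1) - 1/4 \<le> l" "l \<le> real (card V - 1) + 1"
    and root: "level_poly (real (card V - 1)) (real (k - 2)) l = 0"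
    and th: "theta_type (k - 5) E"
  shows "qform V E x \<le> l * (\<Sum>i\<in>V. (x i)\<^sup>2)"
    and "\<exists>y. (\<exists>i\<in>V. y i \<noteq> 0) \<and> (\<forall>i\<in>V. (\<Sum>j\<in>V. y j) - 2 * (\<Sum>j\<in>E `` {i}. y j) = l * y i)"
proof -
  obtain v C a c b where C: "finite C" "card C = k - 5 + 3" "v \<notin> C" "{a, c, b} \<subseteq> C" "distinct [a, b, c]"
    and E: "E = theta_arcs v C a c b" using th unfolding theta_type_def by blast
  have nv: "E `` {v} = C" using C by (auto simp: E theta_arcs_def path_arcs_def)
  have rest: "avoid E v = path_arcs a c b" using C by (auto simp: E theta_arcs_def path_arcs_def avoid_def)
  have d: "deg E v = k - 2" using C(2) k by (simp add: deg_def nv)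
  have v: "v \<in> V" using E_sub C(4) by (auto simp: E theta_arcs_def)
  have "l\<^sup>2 > 8" using mult_mono[of 33 l 33 l] l V k by (simp add: power2_eq_square)
  have lb: "level_bounds (real (card V - 1)) (real (deg E v)) l (8 * (l - 3) / (l\<^sup>2 - 8))"
    using k V l level_form[OF refl level_poly_root[OF root \<open>l\<^sup>2 > 8\<close>]] unfolding d
    by unfold_locales auto
  have nbr: "{a, b, c} \<subseteq> E `` {v}" using C(4) nv by auto
  show "qform V E x \<le> l * (\<Sum>i\<in>V. (x i)\<^sup>2)"
    by (rule qform_le_level_path[OF v lb rest C(5) nbr])
  show "\<exists>y. (\<exists>i\<in>V. y i \<noteq> 0) \<and> (\<forall>i\<in>V. (\<Sum>j\<in>V. y j) - 2 * (\<Sum>j\<in>E `` {i}. y j) = l * y i)"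
    using path_eigenvector[OF v lb rest C(5) nbr] by metis
qed

end

section \<open>Eigenvalues of signed complete graphs\<close>

text \<open>
Over the complex numbers there is an eigenvector \<open>w\<close>; symmetry makes its eigenvalue real, and the
real or the imaginary part of \<open>w\<close> is then a real eigenvector. The index is defined as a maximum, so it is
meaningful only once the spectrum is known to be nonempty.
\<close>

lemma real_symmetric_spectrum_nonempty:
  fixes A :: "real mat"
  assumes A: "A \<in> carrier_mat n n" and n: "0 < n"
    and sym: "\<And>i j. i < n \<Longrightarrow> j < n \<Longrightarrow> A $$ (i, j) = A $$ (j, i)"
  shows "spectrum A \<noteq> {}"
proof -
  define B where "B = map_mat complex_of_real A"
  have B: "B \<in> carrier_mat n n" using A by (simp add: B_def)
  obtain \<mu> where "\<mu> \<in> spectrum B" using spectrum_non_empty[OF B n] by auto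
  then obtain w where w: "w \<in> carrier_vec n" "w \<noteq> 0\<^sub>v n" "B *\<^sub>v w = \<mu> \<cdot>\<^sub>v w"
    using B by (auto simp: spectrum_def eigenvalue_def eigenvector_def)
  have eq: "(\<Sum>j<n. complex_of_real (A $$ (i, j)) * w $ j) = \<mu> * w $ i" if i: "i < n" for i
  proof -
    have "(B *\<^sub>v w) $ i = (\<Sum>j<n. complex_of_real (A $$ (i, j)) * w $ j)"
      using i w(1) A by (simp add: B_def scalar_prod_def atLeast0LessThan row_def)
    then show ?thesis using w i by simp
  qed
  define T where "T = (\<Sum>i<n. (cmod (w $ i))\<^sup>2)"
  obtain i0 where i0: "i0 < n" "w $ i0 \<noteq> 0" using w(1,2) by (metis eq_vecI carrier_vecD index_zero_vec)
  have T: "T > 0" unfolding T_def using i0 by (intro sum_pos2[of _ i0]) auto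
  define q where "q = (\<Sum>i<n. \<Sum>j<n. cnj (w $ i) * (complex_of_real (A $$ (i, j)) * w $ j))"
  have q1: "q = \<mu> * of_real T"
  proof -
    have "q = (\<Sum>i<n. cnj (w $ i) * (\<mu> * w $ i))" unfolding q_def by (simp add: sum_distrib_left[symmetric] eq)
    also have "\<dots> = (\<Sum>i<n. \<mu> * of_real ((cmod (w $ i))\<^sup>2))"
      unfolding complex_norm_square by (intro sum.cong) (simp_all only: mult_ac)
    finally show ?thesis by (simp add: T_def sum_distrib_left)
  qed
  have "cnj q = (\<Sum>i<n. \<Sum>j<n. cnj (w $ j) * (complex_of_real (A $$ (j, i)) * w $ i))"
    unfolding q_def cnj_sum by (intro sum.cong) (simp_all add: sym mult_ac)
  also have "\<dots> = q" unfolding q_def by (rule sum.swap)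
  finally have "cnj \<mu> * of_real T = \<mu> * of_real T" unfolding q1 by simp
  then have "cnj \<mu> = \<mu>" using T by simp
  then obtain r where r: "\<mu> = complex_of_real r" by (metis Reals_cases Reals_cnj_iff)
  have "eigenvalue A r" if "y \<in> carrier_vec n" "y \<noteq> 0\<^sub>v n" "\<And>i. i < n \<Longrightarrow> (\<Sum>j<n. A $$ (i, j) * y $ j) = r * y $ i" for y
  proof -
    have "A *\<^sub>v y = r \<cdot>\<^sub>v y"
      using that A by (intro eq_vecI) (auto simp: scalar_prod_def atLeast0LessThan row_def)
    then show ?thesis using that A unfolding eigenvalue_def eigenvector_def by auto
  qed note ev = this
  show ?thesis
  proof (cases "\<exists>i<n. Re (w $ i) \<noteq> 0")
    case True
    have "(\<Sum>j<n. A $$ (i, j) * vec n (\<lambda>j. Re (w $ j)) $ j) = r * vec n (\<lambda>j. Re (w $ j)) $ i" if "i < n" for i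
      using arg_cong[OF eq[OF that], of Re] that by (simp add: r)
    moreover have "vec n (\<lambda>j. Re (w $ j)) \<noteq> 0\<^sub>v n" using True by (metis index_vec index_zero_vec(1))
    ultimately have "eigenvalue A r" by (intro ev) auto
    then show ?thesis by (auto simp: spectrum_def)
  next
    case False
    have "(\<Sum>j<n. A $$ (i, j) * vec n (\<lambda>j. Im (w $ j)) $ j) = r * vec n (\<lambda>j. Im (w $ j)) $ i" if "i < n" for i
      using arg_cong[OF eq[OF that], of Im] that by (simp add: r)
    moreover have "Im (w $ i0) \<noteq> 0" using False i0 by (auto simp: complex_eq_iff)
    then have "vec n (\<lambda>j. Im (w $ j)) \<noteq> 0\<^sub>v n" using i0 by (metis index_vec index_zero_vec(1))
    ultimately have "eigenvalue A r" by (intro ev) auto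
    then show ?thesis by (auto simp: spectrum_def)
  qed
qed

definition complete_mat :: "nat \<Rightarrow> (nat \<times> nat) set \<Rightarrow> real mat" where
  "complete_mat n E = mat n n (\<lambda>(i, j). if i = j then 0 else if (i, j) \<in> E then -1 else 1)"

lemma complete_mat_row_sum:
  assumes E: "arc_graph {..<n} E" and i: "i < n"
  shows "(\<Sum>j<n. complete_mat n E $$ (i, j) * x j) = (\<Sum>j<n. x j) - 2 * (\<Sum>j\<in>E `` {i}. x j) - x i"
proof -
  interpret arc_graph "{..<n}" E by (rule E)
  have "(\<Sum>j<n. complete_mat n E $$ (i, j) * x j)
    = (\<Sum>j<n. x j - 2 * (if j \<in> E `` {i} then x j else 0) - (if j = i then x j else 0))"
    using i E_irreflD[of i i] by (intro sum.cong) (auto simp: complete_mat_def)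
  also have "\<dots> = (\<Sum>j<n. x j) - 2 * (\<Sum>j<n. if j \<in> E `` {i} then x j else 0) - x i"
    using i by (simp add: sum_subtractf sum_distrib_left[symmetric])
  also have "(\<Sum>j<n. if j \<in> E `` {i} then x j else 0) = (\<Sum>j\<in>E `` {i}. x j)"
    using sum.inter_restrict[of "{..<n}" x "E `` {i}"] nbrs_sub[of i] by (simp add: Int_absorb1)
  finally show ?thesis .
qed

text \<open>
With the shift by one the matrix becomes \<open>J - 2 A\<close>, whose form is \<open>qform\<close>.
\<close>

lemma eigenvalue_complete_mat_iff:
  assumes E: "arc_graph {..<n} E"
  shows "eigenvalue (complete_mat n E) \<mu> \<longleftrightarrow>
    (\<exists>x. (\<exists>i\<in>{..<n}. x i \<noteq> 0) \<and> (\<forall>i\<in>{..<n}. (\<Sum>j<n. x j) - 2 * (\<Sum>j\<in>E `` {i}. x j) = (\<mu> + 1) * x i))"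
proof -
  have A: "complete_mat n E \<in> carrier_mat n n" by (simp add: complete_mat_def)
  have row: "(complete_mat n E *\<^sub>v w) $ i = (\<Sum>j<n. w $ j) - 2 * (\<Sum>j\<in>E `` {i}. w $ j) - w $ i"
    if "i < n" "w \<in> carrier_vec n" for i w
  proof -
    have "(complete_mat n E *\<^sub>v w) $ i = (\<Sum>j<n. complete_mat n E $$ (i, j) * w $ j)"
      using that A by (auto simp: scalar_prod_def atLeast0LessThan row_def)
    then show ?thesis using complete_mat_row_sum[OF E that(1), of "\<lambda>j. w $ j"] by simp
  qed
  show ?thesis
  proof
    assume "eigenvalue (complete_mat n E) \<mu>"
    then obtain w where w: "w \<in> carrier_vec n" "w \<noteq> 0\<^sub>v n" "complete_mat n E *\<^sub>v w = \<mu> \<cdot>\<^sub>v w"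
      using A by (auto simp: eigenvalue_def eigenvector_def)
    have "\<exists>i\<in>{..<n}. w $ i \<noteq> 0" using w(1,2) by (metis eq_vecI carrier_vecD index_zero_vec lessThan_iff)
    moreover have "(\<Sum>j<n. w $ j) - 2 * (\<Sum>j\<in>E `` {i}. w $ j) = (\<mu> + 1) * w $ i" if "i \<in> {..<n}" for i
    proof -
      have "(complete_mat n E *\<^sub>v w) $ i = \<mu> * w $ i" using w that by simp
      then show ?thesis using row[of i w] that w(1) by (simp add: algebra_simps)
    qed
    ultimately show "\<exists>x. (\<exists>i\<in>{..<n}. x i \<noteq> 0) \<and> (\<forall>i\<in>{..<n}. (\<Sum>j<n. x j) - 2 * (\<Sum>j\<in>E `` {i}. x j) = (\<mu> + 1) * x i)"
      by (intro exI[of _ "\<lambda>i. w $ i"]) auto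
  next
    assume "\<exists>x. (\<exists>i\<in>{..<n}. x i \<noteq> 0) \<and> (\<forall>i\<in>{..<n}. (\<Sum>j<n. x j) - 2 * (\<Sum>j\<in>E `` {i}. x j) = (\<mu> + 1) * x i)"
    then obtain x where x: "\<exists>i\<in>{..<n}. x i \<noteq> 0"
      "\<And>i. i < n \<Longrightarrow> (\<Sum>j<n. x j) - 2 * (\<Sum>j\<in>E `` {i}. x j) = (\<mu> + 1) * x i" by auto
    interpret arc_graph "{..<n}" E by (rule E)
    have "complete_mat n E *\<^sub>v vec n x = \<mu> \<cdot>\<^sub>v vec n x"
    proof (rule eq_vecI)
      fix i assume "i < dim_vec (\<mu> \<cdot>\<^sub>v vec n x)"
      then have i: "i < n" by simp
      have "(\<Sum>j\<in>E `` {i}. vec n x $ j) = (\<Sum>j\<in>E `` {i}. x j)"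
        using nbrs_sub[of i] by (intro sum.cong) auto
      then show "(complete_mat n E *\<^sub>v vec n x) $ i = (\<mu> \<cdot>\<^sub>v vec n x) $ i"
        using row[OF i, of "vec n x"] x(2)[OF i] i by (simp add: algebra_simps)
    qed (simp add: complete_mat_def)
    moreover have "vec n x \<noteq> 0\<^sub>v n" using x(1) by (metis index_vec index_zero_vec(1) lessThan_iff)
    ultimately show "eigenvalue (complete_mat n E) \<mu>"
      using A unfolding eigenvalue_def eigenvector_def by (intro exI[of _ "vec n x"]) auto
  qed
qed

lemma (in arc_graph) qform_eigenvector:
  assumes "\<And>i. i \<in> V \<Longrightarrow> (\<Sum>j\<in>V. x j) - 2 * (\<Sum>j\<in>E `` {i}. x j) = c * x i"
  shows "qform V E x = c * (\<Sum>i\<in>V. (x i)\<^sup>2)"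
proof -
  have "qform V E x = (\<Sum>i\<in>V. x i * ((\<Sum>j\<in>V. x j) - 2 * (\<Sum>j\<in>E `` {i}. x j)))"
    by (simp add: qform_def sum_arcs power2_eq_square sum_distrib_left sum_distrib_right sum_subtractf algebra_simps)
  also have "\<dots> = (\<Sum>i\<in>V. x i * (c * x i))" using assms by (intro sum.cong) auto
  finally show ?thesis by (simp add: sum_distrib_left power2_eq_square algebra_simps)
qed

lemma complete_mat_spectrum:
  assumes E: "arc_graph {..<n} E" and n: "0 < n"
  shows "finite (spectrum (complete_mat n E))" "spectrum (complete_mat n E) \<noteq> {}"
proof -
  interpret arc_graph "{..<n}" E by (rule E)
  have A: "complete_mat n E \<in> carrier_mat n n" by (simp add: complete_mat_def)
  show "finite (spectrum (complete_mat n E))" by (rule card_finite_spectrum(1)[OF A])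
  show "spectrum (complete_mat n E) \<noteq> {}"
    by (rule real_symmetric_spectrum_nonempty[OF A n]) (auto simp: complete_mat_def dest: E_symD)
qed

section \<open>Isomorphism with the extremal graph\<close>

text \<open>
A digraph isomorphism consists of separate maps on vertices and arcs and of new head and tail maps. On
graphs whose arcs are pairs of vertices, it reduces to a bijection of vertices that carries arcs to arcs.
\<close>

lemma graph_isoE:
  assumes "graph_iso G H"
  obtains f where "inj_on f (pverts G)" "pverts H = f ` pverts G" "parcs H = map_prod f f ` parcs G"
proof -
  obtain h where h: "pre_digraph.digraph_isomorphism (with_proj G) h" "with_proj H = app_iso h (with_proj G)"
    using assms by (auto simp: digraph_iso_def)
  define f where "f = iso_verts h"
  have inj: "inj_on f (pverts G)" using h(1) by (simp add: pre_digraph.digraph_isomorphism_def f_def)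
  have vs: "pverts H = f ` pverts G" using arg_cong[OF h(2), of verts] by (simp add: f_def)
  have as: "parcs H = iso_arcs h ` parcs G" using arg_cong[OF h(2), of arcs] by simp
  have tl: "iso_tail h = fst" "iso_head h = snd"
    using arg_cong[OF h(2), of tail] arg_cong[OF h(2), of head] by simp_all
  have "iso_arcs h e = map_prod f f e" if "e \<in> parcs G" for e
    using h(1) that by (auto simp: pre_digraph.digraph_isomorphism_def tl f_def prod_eq_iff)
  then have "parcs H = map_prod f f ` parcs G" using as by auto
  then show thesis using that inj vs by blast
qed

lemma graph_isoI:
  assumes wf: "\<And>e. e \<in> parcs G \<Longrightarrow> fst e \<in> pverts G \<and> snd e \<in> pverts G"
    and inj: "inj_on f (pverts G)" and vs: "pverts H = f ` pverts G" and as: "parcs H = map_prod f f ` parcs G"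
  shows "graph_iso G H"
proof -
  define h where "h = \<lparr>iso_verts = f, iso_arcs = map_prod f f, iso_head = snd, iso_tail = (fst :: _ \<times> _ \<Rightarrow> _)\<rparr>"
  have "inj_on (map_prod f f) (parcs G)"
    using wf by (intro inj_on_subset[OF map_prod_inj_on[OF inj inj]]) force
  moreover have "wf_digraph (with_proj G)" using wf by unfold_locales auto
  ultimately have "pre_digraph.digraph_isomorphism (with_proj G) h"
    using inj by (auto simp: pre_digraph.digraph_isomorphism_def h_def)
  moreover have "with_proj H = app_iso h (with_proj G)"
    by (simp add: app_iso_def with_proj_def h_def vs as)
  ultimately show ?thesis by (auto simp: digraph_iso_def)
qed

lemma card_arcs_uedges:
  assumes "finite (parcs G)" "sym (parcs G)" "irrefl (parcs G)"
  shows "card (parcs G) = 2 * card (uedges G)"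
proof -
  let ?f = "\<lambda>(u, v). {u, v}"
  have im: "uedges G = ?f ` parcs G" by (auto simp: uedges_def)
  have "card (parcs G) = (\<Sum>e\<in>?f ` parcs G. card {a \<in> parcs G. ?f a = e})"
    using sum.image_gen[OF assms(1), of "\<lambda>_. 1::nat" ?f] by simp
  also have "\<dots> = (\<Sum>e\<in>?f ` parcs G. 2)"
  proof (intro sum.cong refl)
    fix e assume "e \<in> ?f ` parcs G"
    then obtain u v where uv: "(u, v) \<in> parcs G" "e = {u, v}" by auto
    then have "(v, u) \<in> parcs G" "u \<noteq> v" using assms(2,3) by (auto simp: sym_def irrefl_def)
    then have "{a \<in> parcs G. ?f a = e} = {(u, v), (v, u)}" using uv by (auto simp: doubleton_eq_iff)
    then show "card {a \<in> parcs G. ?f a = e} = 2" using \<open>u \<noteq> v\<close> by simp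
  qed
  finally show ?thesis by (simp add: im)
qed

lemma pair_graph_arcs:
  assumes "pair_graph G"
  shows "finite (pverts G)" "finite (parcs G)" "sym (parcs G)" "irrefl (parcs G)"
    "\<And>e. e \<in> parcs G \<Longrightarrow> fst e \<in> pverts G \<and> snd e \<in> pverts G"
proof -
  interpret pair_graph G by (rule assms)
  show "finite (pverts G)" "finite (parcs G)" using pair_finite_verts pair_finite_arcs by auto
  show "sym (parcs G)" using pair_sym_arcs by (simp add: symmetric_def)
  show "irrefl (parcs G)" by (auto simp: irrefl_def dest: pair_no_loops)
  show "\<And>e. e \<in> parcs G \<Longrightarrow> fst e \<in> pverts G \<and> snd e \<in> pverts G"
    using arc_fst_in_verts arc_snd_in_verts by auto
qed

lemma pair_graphI:
  assumes "finite (pverts G)" "sym (parcs G)" "irrefl (parcs G)"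
    and wf: "\<And>e. e \<in> parcs G \<Longrightarrow> fst e \<in> pverts G \<and> snd e \<in> pverts G"
  shows "pair_graph G"
proof -
  have "parcs G \<subseteq> pverts G \<times> pverts G" using wf by force
  then have "finite (parcs G)" using assms(1) finite_subset by blast
  then show ?thesis
    using assms by unfold_locales (auto simp: symmetric_def irrefl_def)
qed

lemma signed_complete_negative:
  assumes "is_signed_complete n B \<Gamma>"
  defines "E \<equiv> parcs (negative_subgraph \<Gamma>)"
  shows "arc_graph {..<n} E" "pverts (negative_subgraph \<Gamma>) = Field E" "adj_mat \<Gamma> = complete_mat n E"
    "graph_iso (negative_subgraph \<Gamma>) B"
proof -
  have U: "pverts (underlying \<Gamma>) = {..<n}"
    "parcs (underlying \<Gamma>) = {(i, j). i < n \<and> j < n \<and> i \<noteq> j}"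
    and sg: "\<And>i j. i < n \<Longrightarrow> j < n \<Longrightarrow> i \<noteq> j \<Longrightarrow> edge_sign \<Gamma> {i, j} \<in> {1, -1}"
    and iso: "graph_iso (negative_subgraph \<Gamma>) B"
  proof -
    show "pverts (underlying \<Gamma>) = {..<n}" using assms by (simp add: is_signed_complete_def)
    show a: "parcs (underlying \<Gamma>) = {(i, j). i < n \<and> j < n \<and> i \<noteq> j}"
      using assms by (auto simp: is_signed_complete_def complete_digraph_def)
    show "graph_iso (negative_subgraph \<Gamma>) B" using assms by (simp add: is_signed_complete_def)
    fix i j assume "i < n" "j < n" "i \<noteq> j"
    then have "{i, j} \<in> uedges (underlying \<Gamma>)" by (auto simp: uedges_def a)
    then show "edge_sign \<Gamma> {i, j} \<in> {1, -1}"
      using assms by (auto simp: is_signed_complete_def is_signed_graph_def)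
  qed
  have E: "E = {(i, j). i < n \<and> j < n \<and> i \<noteq> j \<and> edge_sign \<Gamma> {i, j} = -1}"
    by (auto simp: E_def negative_subgraph_def Let_def U)
  show "graph_iso (negative_subgraph \<Gamma>) B" by (rule iso)
  show "pverts (negative_subgraph \<Gamma>) = Field E"
    by (simp add: E_def negative_subgraph_def Let_def)
  show "arc_graph {..<n} E"
    by unfold_locales (auto simp: E sym_def irrefl_def insert_commute)
  show "adj_mat \<Gamma> = complete_mat n E"
    using sg by (intro eq_matI) (auto simp: adj_mat_def complete_mat_def U E)
qed

lemma signed_complete_counts:
  assumes G: "is_signed_complete n B \<Gamma>" and B: "bicyclic B" "card (uedges B) = k"
  defines "E \<equiv> parcs (negative_subgraph \<Gamma>)"
  shows "card E = 2 * k" "card (Field E) = k - 1"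
proof -
  note neg = signed_complete_negative[OF G, folded E_def]
  have pg: "pair_graph B" and cB: "card (uedges B) = card (pverts B) + 1" using B by (auto simp: bicyclic_def)
  note pb = pair_graph_arcs[OF pg]
  obtain f where f: "inj_on f (Field E)" "pverts B = f ` Field E" "parcs B = map_prod f f ` E"
    using graph_isoE[OF neg(4)] neg(2) E_def by metis
  have "card (pverts B) = card (Field E)" using f by (simp add: card_image)
  then show "card (Field E) = k - 1" using cB B by simp
  have "inj_on (map_prod f f) E"
    by (rule inj_on_subset[OF map_prod_inj_on[OF f(1) f(1)]]) (auto simp: Field_def)
  then have "card (parcs B) = card E" using f by (simp add: card_image)
  then show "card E = 2 * k" using card_arcs_uedges[OF pb(2,3,4)] B by simp
qed

lemma theta2_0_arcs: "parcs (theta2_0 r) = theta_arcs 1 ({..<r + 4} - {1}) 2 0 3"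
proof -
  define X where "X = {4..<r + 4}"
  have C: "{..<r + 4} - {1} = {0, 2, 3} \<union> X" by (auto simp: X_def)
  have X: "{(1, p) | p. p \<in> X} = {1} \<times> X" "(\<lambda>(a, b). (b, a)) ` ({1} \<times> X) = X \<times> {1}" by auto
  show ?thesis
    unfolding C theta_arcs_def path_arcs_def theta2_0_def X_def[symmetric] symcl_def X(1)
    by (simp only: image_Un X(2) image_insert image_empty prod.case pair_pre_digraph.simps) blast
qed

lemma theta2_0_verts: "pverts (theta2_0 r) = {..<r + 4}"
  by (simp add: theta2_0_def)

lemma Field_theta_arcs: "{a, c, b} \<subseteq> C \<Longrightarrow> Field (theta_arcs v C a c b) = insert v C"
  by (auto simp: theta_arcs_def path_arcs_def Field_def)

lemma map_prod_theta_arcs: "map_prod f f ` theta_arcs v C a c b = theta_arcs (f v) (f ` C) (f a) (f c) (f b)"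
proof -
  have "map_prod f f ` (A \<times> B) = f ` A \<times> f ` B" for A B by (auto simp: map_prod_def image_iff)
  then show ?thesis by (simp add: theta_arcs_def path_arcs_def image_Un)
qed

text \<open>
The hub \<open>v\<close> goes to \<open>1\<close>, the middle vertex of the path to \<open>0\<close>, its ends to \<open>2\<close> and \<open>3\<close>, and the other
neighbours of the hub are numbered arbitrarily from \<open>4\<close> on.
\<close>

lemma theta_type_iso_theta2_0:
  assumes E: "theta_type r (parcs G)" and G: "pverts G = Field (parcs G)"
  shows "graph_iso G (theta2_0 r)"
proof -
  obtain v C a c b where C: "finite C" "card C = r + 3" "v \<notin> C" "{a, c, b} \<subseteq> C" "distinct [a, b, c]"
    and E: "parcs G = theta_arcs v C a c b" using E unfolding theta_type_def by blast
  have "card (C - {a, b, c}) = card {4..<r + 4}"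
    using C by (simp add: card_Diff_subset)
  then obtain g where g: "bij_betw g (C - {a, b, c}) {4..<r + 4}"
    using C by (metis finite_Diff finite_atLeastLessThan finite_same_card_bij)
  define f where "f i = (if i = v then 1 else if i = c then 0 else if i = a then 2 else if i = b then 3 else g i)" for i
  have ne: "c \<noteq> v" "a \<noteq> v" "b \<noteq> v" "a \<noteq> c" "b \<noteq> c" "b \<noteq> a" using C by auto
  have fs: "f v = 1" "f c = 0" "f a = 2" "f b = 3" using ne by (auto simp: f_def)
  have fg: "f ` (C - {a, b, c}) = {4..<r + 4}"
  proof -
    have "f ` (C - {a, b, c}) = g ` (C - {a, b, c})" using C by (intro image_cong) (auto simp: f_def)
    then show ?thesis using g by (simp add: bij_betw_def)
  qed
  have Cs: "C = {c, a, b} \<union> (C - {a, b, c})" using C by auto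
  have fC: "f ` C = {..<r + 4} - {1}"
  proof -
    have "f ` C = {0, 2, 3} \<union> {4..<r + 4}"
      by (subst Cs) (simp only: image_Un fg, simp add: fs insert_commute)
    then show ?thesis by auto
  qed
  have V: "pverts G = insert v C" using G E C(4) Field_theta_arcs[of a c b C v] by simp
  have im: "f ` insert v C = {..<r + 4}" using fC fs by auto
  show ?thesis
  proof (rule graph_isoI)
    show "inj_on f (pverts G)"
      unfolding V using C im by (intro eq_card_imp_inj_on) auto
    show "pverts (theta2_0 r) = f ` pverts G" using im V by (simp add: theta2_0_verts)
    show "parcs (theta2_0 r) = map_prod f f ` parcs G"
      by (simp add: theta2_0_arcs E map_prod_theta_arcs fs fC)
    show "\<And>e. e \<in> parcs G \<Longrightarrow> fst e \<in> pverts G \<and> snd e \<in> pverts G"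
      unfolding G by (auto simp: Field_def)
  qed
qed

lemma iso_theta2_0_theta_type:
  assumes "graph_iso (theta2_0 r) G"
  shows "theta_type r (parcs G)"
proof -
  obtain f where f: "inj_on f {..<r + 4}" "parcs G = map_prod f f ` parcs (theta2_0 r)"
    using graph_isoE[OF assms] by (metis theta2_0_verts)
  have E: "parcs G = theta_arcs (f 1) (f ` ({..<r + 4} - {1})) (f 2) (f 0) (f 3)"
    unfolding f(2) theta2_0_arcs map_prod_theta_arcs ..
  have fne: "f i \<noteq> f j" if "i \<noteq> j" "i < r + 4" "j < r + 4" for i j
    using f(1) that by (auto dest: inj_onD)
  have c: "finite (f ` ({..<r + 4} - {1}))" "card (f ` ({..<r + 4} - {1})) = r + 3"
    using card_image[OF inj_on_subset[OF f(1)], of "{..<r + 4} - {1}"] by simp_all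
  moreover have "f 1 \<notin> f ` ({..<r + 4} - {1})"
    using inj_on_image_mem_iff[OF f(1), of 1 "{..<r + 4} - {1}"] by auto
  moreover have "{f 2, f 0, f 3} \<subseteq> f ` ({..<r + 4} - {1})" by auto
  moreover have "distinct [f 2, f 3, f 0]" using fne by simp
  ultimately show ?thesis unfolding theta_type_def
    by (intro exI[of _ "f 1"] exI[of _ "f ` ({..<r + 4} - {1})"] exI[of _ "f 2"] exI[of _ "f 0"] exI[of _ "f 3"] conjI E)
qed

lemma graph_iso_sym:
  assumes "graph_iso G H" and "\<And>e. e \<in> parcs G \<Longrightarrow> fst e \<in> pverts G \<and> snd e \<in> pverts G"
  shows "graph_iso H G"
proof (rule digraph_iso_swap[OF _ assms(1)])
  show "wf_digraph (with_proj G)" using assms(2) by unfold_locales auto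
qed

lemma pair_graph_theta2_0: "pair_graph (theta2_0 r)"
  by (rule pair_graphI)
    (auto simp: theta2_0_arcs theta2_0_verts theta_arcs_def path_arcs_def sym_def irrefl_def)

lemma bicyclic_theta2_0:
  shows "bicyclic (theta2_0 r)" and "card (uedges (theta2_0 r)) = r + 5"
proof -
  note pg = pair_graph_arcs[OF pair_graph_theta2_0[of r]]
  let ?C = "{..<r + 4} - {1::nat}"
  have "card (parcs (theta2_0 r)) = 2 * (r + 5)"
  proof -
    have "parcs (theta2_0 r) = ({1} \<times> ?C) \<union> ((?C \<times> {1}) \<union> path_arcs 2 0 3)"
      by (simp add: theta2_0_arcs theta_arcs_def Un_assoc)
    moreover have "card (({1} \<times> ?C) \<union> ((?C \<times> {1}) \<union> path_arcs 2 0 3)) = card ({1::nat} \<times> ?C) + (card (?C \<times> {1::nat}) + card (path_arcs 2 0 (3::nat)))"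
      by (subst card_Un_disjoint card_Un_disjoint, auto simp: path_arcs_def)+
    moreover have "card (path_arcs 2 0 (3::nat)) = 4" by (simp add: path_arcs_def)
    ultimately show ?thesis by (simp add: card_cartesian_product)
  qed
  then show u: "card (uedges (theta2_0 r)) = r + 5" using card_arcs_uedges[OF pg(2,3,4)] by simp
  have "Digraph_Component.connected (with_proj (theta2_0 r))"
  proof -
    have adj: "(1, i) \<in> parcs (mk_symmetric (with_proj (theta2_0 r)))" "(i, 1) \<in> parcs (mk_symmetric (with_proj (theta2_0 r)))"
      if "i < r + 4" "i \<noteq> 1" for i
      using that by (auto simp: parcs_mk_symmetric theta2_0_arcs theta_arcs_def)
    define S where "S = mk_symmetric (with_proj (theta2_0 r))"
    have S: "pverts S = {..<r + 4}" by (simp add: S_def mk_symmetric_def theta2_0_verts)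
    have "(i, 1) \<in> rtrancl_on (pverts S) (parcs S) \<and> (1, i) \<in> rtrancl_on (pverts S) (parcs S)" if "i < r + 4" for i
    proof (cases "i = 1")
      case True then show ?thesis by (simp add: S)
    next
      case False
      have "(1, i) \<in> rtrancl_on (pverts S) (parcs S)" "(i, 1) \<in> rtrancl_on (pverts S) (parcs S)"
        by (rule rtrancl_on_into_rtrancl_on[OF rtrancl_on_refl adj(1)[OF that False, folded S_def]];
            use that in \<open>simp add: S\<close>)
          (rule rtrancl_on_into_rtrancl_on[OF rtrancl_on_refl adj(2)[OF that False, folded S_def]];
            use that in \<open>simp add: S\<close>)
      then show ?thesis by simp
    qed
    then have "(i, j) \<in> rtrancl_on (pverts S) (parcs S)" if "i < r + 4" "j < r + 4" for i j
      using that rtrancl_on_trans by metis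
    then have "\<forall>u\<in>pverts S. \<forall>w\<in>pverts S. (u, w) \<in> rtrancl_on (pverts S) (parcs S)" by (simp add: S)
    moreover have "pverts S \<noteq> {}" unfolding S by (metis empty_iff lessThan_iff zero_less_numeral trans_less_add2)
    ultimately show ?thesis
      unfolding connected_def strongly_connected_def S_def[symmetric] reachable_def by simp
  qed
  then show "bicyclic (theta2_0 r)"
    using pair_graph_theta2_0[of r] u by (simp add: bicyclic_def theta2_0_verts)
qed

lemma signed_complete_theta2_0_exists:
  assumes "r + 4 \<le> n"
  shows "\<exists>\<Gamma>. is_signed_complete n (theta2_0 r) \<Gamma>"
proof -
  define U :: "nat pair_pre_digraph" where "U = \<lparr>pverts = {..<n}, parcs = {(i, j). i < n \<and> j < n \<and> i \<noteq> j}\<rparr>"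
  define \<Gamma> where "\<Gamma> = \<lparr>underlying = U, edge_sign = (\<lambda>e. if e \<in> uedges (theta2_0 r) then -1 else 1)\<rparr>"
  note pg = pair_graph_arcs[OF pair_graph_theta2_0[of r]]
  have U: "pair_graph U" by (rule pair_graphI) (auto simp: U_def sym_def irrefl_def)
  have ue: "{i, j} \<in> uedges (theta2_0 r) \<longleftrightarrow> (i, j) \<in> parcs (theta2_0 r)" for i j
    using pg(3) by (auto simp: uedges_def doubleton_eq_iff sym_def)
  have sub: "i < n \<and> j < n \<and> i \<noteq> j" if "(i, j) \<in> parcs (theta2_0 r)" for i j
    using pg(4) pg(5)[OF that] that assms by (auto simp: irrefl_def theta2_0_verts)
  have "negative_subgraph \<Gamma> = \<lparr>pverts = Field (parcs (theta2_0 r)), parcs = parcs (theta2_0 r)\<rparr>"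
  proof -
    have "{(u, v) \<in> parcs U. edge_sign \<Gamma> {u, v} = -1} = parcs (theta2_0 r)"
      using sub by (auto simp: \<Gamma>_def U_def ue)
    then show ?thesis by (simp add: negative_subgraph_def Let_def \<Gamma>_def)
  qed
  moreover have "Field (parcs (theta2_0 r)) = pverts (theta2_0 r)"
    by (auto simp: theta2_0_arcs theta2_0_verts Field_theta_arcs)
  ultimately have "negative_subgraph \<Gamma> = theta2_0 r" by simp
  moreover have "graph_iso (theta2_0 r) (theta2_0 r)"
    by (rule graph_isoI[of _ id]) (use pg in \<open>auto simp: map_prod_def\<close>)
  moreover have "complete_digraph n (with_proj U)"
    unfolding complete_digraph_pair_def by (auto simp: U_def)
  ultimately have "is_signed_complete n (theta2_0 r) \<Gamma>"
    using U by (auto simp: is_signed_complete_def is_signed_graph_def \<Gamma>_def U_def)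
  then show ?thesis ..
qed

section \<open>The index\<close>

text \<open>
The value of the index is pinned down by the level: an eigenvector of eigenvalue \<open>\<mu>\<close> has form value
\<open>(\<mu> + 1) * |x|\<^sup>2\<close>, which is compared with \<open>l * |x|\<^sup>2\<close>.
\<close>

lemma signed_index_theta:
  assumes G: "is_signed_complete n B \<Gamma>" and B: "bicyclic B" "card (uedges B) = k"
    and k: "15 \<le> k" and n: "k + 20 \<le> n"
    and l: "real (n - 1) - 1/4 \<le> l" "l \<le> real (n - 1) + 1"
    and root: "level_poly (real (n - 1)) (real (k - 2)) l = 0"
  shows "graph_iso B (theta2_0 (k - 5)) \<Longrightarrow> signed_index \<Gamma> = l - 1"
    and "\<not> graph_iso B (theta2_0 (k - 5)) \<Longrightarrow> signed_index \<Gamma> < l - 1"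
proof -
  define E where "E = parcs (negative_subgraph \<Gamma>)"
  note neg = signed_complete_negative[OF G, folded E_def]
  note cnt = signed_complete_counts[OF G B, folded E_def]
  interpret arc_graph "{..<n}" E by (rule neg(1))
  have n0: "0 < n" using n by simp
  note sp = complete_mat_spectrum[OF neg(1) n0]
  have idx: "signed_index \<Gamma> = Max (spectrum (complete_mat n E))" by (simp add: signed_index_def neg(3))
  have ev: "\<exists>x. (\<exists>i\<in>{..<n}. x i \<noteq> 0) \<and> qform {..<n} E x = (\<mu> + 1) * (\<Sum>i<n. (x i)\<^sup>2)" if \<mu>: "\<mu> \<in> spectrum (complete_mat n E)" for \<mu>
  proof -
    have "eigenvalue (complete_mat n E) \<mu>" using \<mu> by (simp add: spectrum_def)
    then obtain x where x: "\<exists>i\<in>{..<n}. x i \<noteq> 0" "\<And>i. i \<in> {..<n} \<Longrightarrow> (\<Sum>j<n. x j) - 2 * (\<Sum>j\<in>E `` {i}. x j) = (\<mu> + 1) * x i"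
      unfolding eigenvalue_complete_mat_iff[OF neg(1)] by blast
    then show ?thesis using qform_eigenvector[of x "\<mu> + 1"] by blast
  qed
  have nz: "0 < (\<Sum>i<n. (x i)\<^sup>2)" if "\<exists>i\<in>{..<n}. x i \<noteq> 0" for x :: "nat \<Rightarrow> real"
    using that by (auto intro!: sum_pos2)
  have wfneg: "\<And>e. e \<in> parcs (negative_subgraph \<Gamma>) \<Longrightarrow> fst e \<in> pverts (negative_subgraph \<Gamma>) \<and> snd e \<in> pverts (negative_subgraph \<Gamma>)"
    unfolding neg(2) E_def by (auto simp: Field_def)
  have wfB: "\<And>e. e \<in> parcs B \<Longrightarrow> fst e \<in> pverts B \<and> snd e \<in> pverts B"
    using pair_graph_arcs(5)[of B] B(1) by (simp add: bicyclic_def)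
  have th: "theta_type (k - 5) E \<longleftrightarrow> graph_iso B (theta2_0 (k - 5))"
  proof
    assume "theta_type (k - 5) E"
    then have "graph_iso (negative_subgraph \<Gamma>) (theta2_0 (k - 5))"
      by (intro theta_type_iso_theta2_0) (auto simp: neg(2) E_def)
    then show "graph_iso B (theta2_0 (k - 5))"
      using digraph_iso_trans[OF graph_iso_sym[OF neg(4) wfneg]] by blast
  next
    assume "graph_iso B (theta2_0 (k - 5))"
    then have "graph_iso (negative_subgraph \<Gamma>) (theta2_0 (k - 5))"
      using digraph_iso_trans[OF neg(4)] by blast
    then have "graph_iso (theta2_0 (k - 5)) (negative_subgraph \<Gamma>)"
      by (rule graph_iso_sym[OF _ wfneg])
    then show "theta_type (k - 5) E" unfolding E_def by (rule iso_theta2_0_theta_type)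
  qed
  have V: "k + 20 \<le> card {..<n}" "real (card {..<n} - 1) - 1/4 \<le> l" "l \<le> real (card {..<n} - 1) + 1"
    "level_poly (real (card {..<n} - 1)) (real (k - 2)) l = 0"
    using n l root by simp_all
  show "signed_index \<Gamma> < l - 1" if "\<not> graph_iso B (theta2_0 (k - 5))"
  proof -
    have "Max (spectrum (complete_mat n E)) \<in> spectrum (complete_mat n E)" using sp by (rule Max_in)
    then obtain x where x: "\<exists>i\<in>{..<n}. x i \<noteq> 0" "qform {..<n} E x = (signed_index \<Gamma> + 1) * (\<Sum>i<n. (x i)\<^sup>2)"
      using ev idx by metis
    have "qform {..<n} E x < l * (\<Sum>i<n. (x i)\<^sup>2)"
      using theta_or_below_level[OF k cnt V _ x(1)] that th by blast
    then show ?thesis using x(2) nz[OF x(1)] by simp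
  qed
  show "signed_index \<Gamma> = l - 1" if "graph_iso B (theta2_0 (k - 5))"
  proof -
    note att = theta_attains_level[OF k V th[THEN iffD2, OF that]]
    have "eigenvalue (complete_mat n E) (l - 1)"
      unfolding eigenvalue_complete_mat_iff[OF neg(1)] using att(2) by simp
    then have "l - 1 \<in> spectrum (complete_mat n E)" by (simp add: spectrum_def)
    moreover have "\<mu> \<le> l - 1" if \<mu>: "\<mu> \<in> spectrum (complete_mat n E)" for \<mu>
    proof -
      obtain x where x: "\<exists>i\<in>{..<n}. x i \<noteq> 0" "qform {..<n} E x = (\<mu> + 1) * (\<Sum>i<n. (x i)\<^sup>2)"
        using ev[OF \<mu>] by blast
      then show ?thesis using att(1)[of x] nz[OF x(1)] by simp
    qed
    ultimately show ?thesis unfolding idx using sp by (intro Max_eqI) auto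
  qed
qed

theorem theorem1p1:
  fixes k n :: nat
    and B :: "'a pair_pre_digraph"
    and \<Gamma> :: "nat signed_graph"
  assumes "k \<ge> 15"
    and "n \<ge> k + 20"
    and "bicyclic B"
    and "card (uedges B) = k"
    and "is_signed_complete n B \<Gamma>"
  shows "(\<forall>(B' :: nat pair_pre_digraph) \<Gamma>'.
            bicyclic B' \<and> card (uedges B') = k \<and> is_signed_complete n B' \<Gamma>'
              \<longrightarrow> signed_index \<Gamma>' \<le> signed_index \<Gamma>)
         \<longleftrightarrow> graph_iso B (theta2_0 (k - 5))"
proof -
  have "34 \<le> real (n - 1)" "13 \<le> real (k - 2)" "real (k - 2) + 21 \<le> real (n - 1)"
    using assms(1,2) by auto
  then obtain l where l: "real (n - 1) - 1/4 \<le> l" "l \<le> real (n - 1) + 1"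
    "level_poly (real (n - 1)) (real (k - 2)) l = 0"
    by (rule level_exists)
  show ?thesis
  proof
    assume max: "\<forall>(B' :: nat pair_pre_digraph) \<Gamma>'.
            bicyclic B' \<and> card (uedges B') = k \<and> is_signed_complete n B' \<Gamma>'
              \<longrightarrow> signed_index \<Gamma>' \<le> signed_index \<Gamma>"
    obtain \<Gamma>' where G': "is_signed_complete n (theta2_0 (k - 5)) \<Gamma>'"
    proof -
      have "k - 5 + 4 \<le> n" using assms(2) by simp
      then show thesis using signed_complete_theta2_0_exists that by blast
    qed
    have b: "bicyclic (theta2_0 (k - 5))" "card (uedges (theta2_0 (k - 5))) = k"
      using bicyclic_theta2_0[of "k - 5"] assms(1) by auto
    have "graph_iso (theta2_0 (k - 5)) (theta2_0 (k - 5))"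
      by (rule graph_isoI[of _ id]) (use pair_graph_arcs[OF pair_graph_theta2_0] in \<open>auto simp: map_prod_def\<close>)
    then have "signed_index \<Gamma>' = l - 1"
      by (rule signed_index_theta(1)[OF G' b assms(1,2) l])
    then have "l - 1 \<le> signed_index \<Gamma>" using max b G' by metis
    then show "graph_iso B (theta2_0 (k - 5))"
      using signed_index_theta(2)[OF assms(5,3,4,1,2) l] by linarith
  next
    assume "graph_iso B (theta2_0 (k - 5))"
    then have "signed_index \<Gamma> = l - 1" by (rule signed_index_theta(1)[OF assms(5,3,4,1,2) l])
    moreover have "signed_index \<Gamma>' \<le> l - 1"
      if "bicyclic B'" "card (uedges B') = k" "is_signed_complete n B' \<Gamma>'" for B' :: "nat pair_pre_digraph" and \<Gamma>'
      using signed_index_theta[OF that(3,1,2) assms(1,2) l] by (cases "graph_iso B' (theta2_0 (k - 5))") auto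
    ultimately show "\<forall>(B' :: nat pair_pre_digraph) \<Gamma>'.
            bicyclic B' \<and> card (uedges B') = k \<and> is_signed_complete n B' \<Gamma>'
              \<longrightarrow> signed_index \<Gamma>' \<le> signed_index \<Gamma>" by auto
  qed
qed

end
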